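(* Let $L$ be a finite simplicial complex with vertex set $[m]=\{1,\dots,m\}$, and let $(\mathbf{A},\mathbf{B})=\{(A_i,B_i)\}_{i\in[m]}$ be a family of pairs of finite CW complexes. Then the Euler characteristic of the polyhedral product $\mathcal{Z}_L(\mathbf{A},\mathbf{B})$ is $$\chi(\mathcal{Z}_L(\mathbf{A},\mathbf{B}))=\sum_{J\in\mathcal{S}(L)}(\mathbf{e}(\mathbf{A})-\mathbf{e}(\mathbf{B}))_J\,\mathbf{e}(\mathbf{B})_{[m]-J}.$$
   Context: $\mathcal{S}(L)$ denotes the poset of vertex sets of simplices of $L$, including the empty simplex $\emptyset$; so $\mathcal{S}(L)$ is a collection of subsets of $[m]$. A pair of finite CW complexes $(A_i,B_i)$ means that $A_i$ is a finite CW complex and $B_i$ is a subcomplex. For a point $\mathbf{x}=(x_i)_{i\in[m]}$ of the product $\prod\mathbf{A}:=\prod_{i\in[m]}A_i$, put $\operatorname{Supp}(\mathbf{x}):=\{i\in[m]\mid x_i\notin B_i\}$. The polyhedral product is the subspace $$\mathcal{Z}_L(\mathbf{A},\mathbf{B})=\{\mathbf{x}\in\prod\mathbf{A}\mid \operatorname{Supp}(\mathbf{x})\in\mathcal{S}(L)\}.$$ Here $\chi$ is the Euler characteristic, $\mathbf{e}(\mathbf{A}):=(\chi(A_i))_{i\in[m]}$ and $\mathbf{e}(\mathbf{B}):=(\chi(B_i))_{i\in[m]}$; the difference of two $m$-tuples is taken coordinatewise. For an $I$-tuple $\mathbf{t}=(t_i)_{i\in I}$ and $J\subseteq I$, $\mathbf{t}_J:=\prod_{j\in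 J}t_j$ (so $\mathbf{t}_\emptyset=1$). *)

theory Defs
  imports "HOL-Homology.Homology"
begin

text \<open>A simplicial complex with vertex set \<open>V\<close>, given by the poset \<open>\<S>(L)\<close> of vertex sets of its
  simplices. The empty simplex is always included.\<close>

definition simplex_poset :: "'v set \<Rightarrow> 'v set set \<Rightarrow> bool" where
  "simplex_poset V S \<longleftrightarrow>
     finite V \<and> S \<subseteq> Pow V \<and> {} \<in> S \<and> (\<forall>v\<in>V. {v} \<in> S) \<and>
     (\<forall>\<sigma>\<in>S. \<forall>\<tau>. \<tau> \<subseteq> \<sigma> \<longrightarrow> \<tau> \<in> S)"

text \<open>The closed \<open>n\<close>-disk, its interior and its boundary. For \<open>n = 0\<close> the disk and its interior are
  a single point and the boundary is empty.\<close>

definition disk :: "nat \<Rightarrow> (nat \<Rightarrow> real) topology" where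
  "disk n = subtopology (Euclidean_space n) {x. (\<Sum>i<n. x i ^ 2) \<le> 1}"

definition disk_interior :: "nat \<Rightarrow> (nat \<Rightarrow> real) set" where
  "disk_interior n = {x \<in> topspace (Euclidean_space n). (\<Sum>i<n. x i ^ 2) < 1}"

definition disk_boundary :: "nat \<Rightarrow> (nat \<Rightarrow> real) set" where
  "disk_boundary n = {x \<in> topspace (Euclidean_space n). (\<Sum>i<n. x i ^ 2) = 1}"

text \<open>\<open>E\<close> is the set of open cells of a finite CW structure on \<open>X\<close>, each cell paired with its
  dimension. As there are finitely many cells, closure-finiteness and the weak topology come for
  free; as the disk is compact and \<open>X\<close> is Hausdorff, a characteristic map is a homeomorphism from
  the open disk onto its cell. The empty space is allowed.\<close>

definition finite_CW_structure :: "'a topology \<Rightarrow> (nat \<times> 'a set) set \<Rightarrow> bool" where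
  "finite_CW_structure X E \<longleftrightarrow>
     Hausdorff_space X \<and> finite E \<and>
     topspace X = (\<Union>(n, e)\<in>E. e) \<and>
     pairwise (\<lambda>c d. disjnt (snd c) (snd d)) E \<and>
     (\<forall>(n, e)\<in>E. \<exists>\<phi>. continuous_map (disk n) X \<phi> \<and>
        bij_betw \<phi> (disk_interior n) e \<and>
        \<phi> ` disk_boundary n \<subseteq> (\<Union>(k, d)\<in>{(k, d) \<in> E. k < n}. d))"

definition CW_subcomplex :: "'a topology \<Rightarrow> (nat \<times> 'a set) set \<Rightarrow> 'a set \<Rightarrow> bool" where
  "CW_subcomplex X E B \<longleftrightarrow> closedin X B \<and> (\<exists>F\<subseteq>E. B = (\<Union>(n, e)\<in>F. e))"

definition finite_CW_pair :: "'a topology \<Rightarrow> 'a set \<Rightarrow> bool" where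
  "finite_CW_pair X B \<longleftrightarrow> (\<exists>E. finite_CW_structure X E \<and> CW_subcomplex X E B)"

text \<open>The rank of an abelian group, as the largest size of a finite \<open>\<int>\<close>-linearly independent subset.
  The value is only meaningful for groups of finite rank.\<close>

definition int_independent :: "('a, 'b) monoid_scheme \<Rightarrow> 'a set \<Rightarrow> bool" where
  "int_independent G S \<longleftrightarrow> finite S \<and> S \<subseteq> carrier G \<and>
     (\<forall>c :: 'a \<Rightarrow> int.
        finprod G (\<lambda>x. x [^]\<^bsub>G\<^esub> c x) S = \<one>\<^bsub>G\<^esub> \<longrightarrow> (\<forall>x\<in>S. c x = 0))"

definition abelian_rank :: "('a, 'b) monoid_scheme \<Rightarrow> nat" where
  "abelian_rank G = Sup (card ` {S. int_independent G S})"

definition betti :: "nat \<Rightarrow> 'a topology \<Rightarrow> nat" where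
  "betti p X = abelian_rank (homology_group (int p) X)"

text \<open>The Euler characteristic is that of singular homology, so it depends on the space only. The
  value is only meaningful when all Betti numbers are finite and almost all vanish.\<close>

definition euler_characteristic :: "'a topology \<Rightarrow> int" where
  "euler_characteristic X = (\<Sum>p | betti p X \<noteq> 0. (-1) ^ p * int (betti p X))"

definition Supp :: "nat \<Rightarrow> (nat \<Rightarrow> 'a set) \<Rightarrow> (nat \<Rightarrow> 'a) \<Rightarrow> nat set" where
  "Supp m B x = {i \<in> {1..m}. x i \<notin> B i}"

definition polyhedral_product ::
  "nat \<Rightarrow> nat set set \<Rightarrow> (nat \<Rightarrow> 'a topology) \<Rightarrow> (nat \<Rightarrow> 'a set) \<Rightarrow> (nat \<Rightarrow> 'a) topology" where
  "polyhedral_product m S A B =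
     (let P = product_topology A {1..m}
      in subtopology P {x \<in> topspace P. Supp m B x \<in> S})"

end

theory Submission
  imports Defs "HOL-Analysis.Abstract_Topological_Spaces"
begin

text \<open>
  The Euler characteristic of a finite CW complex is the alternating sum of its numbers of cells, and the
  polyhedral product inherits a cell structure from the pairs: its open cells are the products of
  open cells of the factors such that the indices of the cells not in the subcomplexes form a simplex
  (\<open>polydisk_complex_polyhedral_product\<close>). A product cell contributes the product of the signs of its
  factors. Collecting the product cells by their support \<open>J\<close>, the sum factors: an index in \<open>J\<close>
  contributes the cells of the pair outside the subcomplex, hence the difference of the two Euler
  characteristics, and any other index contributes the cells of the subcomplex
  (\<open>sum_over_supports\<close>).

  What has to be shown is that singular homology counts cells (\<open>has_euler_polydisk_complex\<close>). A cell
  of maximal dimension \<open>N\<close> is removed in two steps. Removing only its centre \<open>x\<close> changes the Euler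
  characteristic by that of the relative homology of \<open>(X, X - {x})\<close>, by the long exact sequence
  and rank-nullity for abelian groups (\<open>has_rank_kernel_image\<close>, \<open>has_euler_exact\<close>). By excision this
  is the local homology of \<open>\<real>\<^sup>N\<close> at the origin (\<open>local_homology_attach_cell\<close>,
  \<open>has_euler_Euclidean_punctured\<close>), of Euler characteristic \<open>(-1) ^ N\<close>. The rest of the cell is then
  pushed radially into the union of the other cells (\<open>homology_attach_cell_punctured\<close>).

  Both steps work for every model of a cell with a radial deformation and an interior that is open in
  a Euclidean space. They are carried out for products of disks: a finite CW complex is the case of a
  single factor, and the product of the characteristic maps of cells is the characteristic map of
  the product cell.
\<close>

section \<open>Ranks of abelian groups\<close>

text \<open>More unknowns than equations over the integers: Gaussian elimination without division. A pivot
  row \<open>v\<close> with \<open>a v t \<noteq> 0\<close> eliminates the equation \<open>t\<close>, by cross-multiplication instead of dividing.\<close>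

lemma integer_homogeneous_system:
  fixes a :: "'u \<Rightarrow> 't \<Rightarrow> int"
  assumes "finite T" "finite U" "card T < card U"
  shows "\<exists>c. (\<exists>u\<in>U. c u \<noteq> 0) \<and> (\<forall>t\<in>T. (\<Sum>u\<in>U. c u * a u t) = 0)"
  using assms
proof (induction T arbitrary: U a)
  case empty
  then have "U \<noteq> {}" by auto
  then show ?case by (intro exI[of _ "\<lambda>_. 1"]) auto
next
  case (insert t T)
  show ?case
  proof (cases "\<forall>u\<in>U. a u t = 0")
    case True
    have "card T < card U" using insert by simp
    from insert.IH[OF insert.prems(1) this, of a] True show ?thesis
      by (auto intro!: sum.neutral)
  next
    case False
    then obtain v where v: "v \<in> U" "a v t \<noteq> 0" by blast
    define U' where "U' = U - {v}"
    have U': "finite U'" "v \<notin> U'" "U = insert v U'" and "card T < card U'"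
      using insert v by (auto simp: U'_def)
    from insert.IH[OF U'(1) \<open>card T < card U'\<close>, of "\<lambda>u s. a v t * a u s - a u t * a v s"]
    obtain c where c: "\<exists>u\<in>U'. c u \<noteq> 0"
      "\<And>s. s \<in> T \<Longrightarrow> (\<Sum>u\<in>U'. c u * (a v t * a u s - a u t * a v s)) = 0" by blast
    \<comment> \<open>Scaling the solution of the reduced system by the pivot makes the value at \<open>v\<close> an integer.\<close>
    define d where "d u = (if u = v then - (\<Sum>u\<in>U'. c u * a u t) else a v t * c u)" for u
    have d: "(\<Sum>u\<in>U. d u * a u s) = (\<Sum>u\<in>U'. c u * (a v t * a u s - a u t * a v s))" for s
    proof -
      have "(\<Sum>u\<in>U'. d u * a u s) = (\<Sum>u\<in>U'. a v t * c u * a u s)"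
        using U' by (intro sum.cong) (auto simp: d_def)
      then have "(\<Sum>u\<in>U. d u * a u s)
        = - (\<Sum>u\<in>U'. c u * a u t) * a v s + (\<Sum>u\<in>U'. a v t * c u * a u s)"
        using U' by (simp add: d_def)
      also have "\<dots> = (\<Sum>u\<in>U'. c u * (a v t * a u s - a u t * a v s))"
        by (simp add: sum_distrib_right sum_distrib_left sum_subtractf algebra_simps)
      finally show ?thesis .
    qed
    have "\<exists>u\<in>U. d u \<noteq> 0" using c(1) U' v by (auto simp: d_def)
    moreover have "(\<Sum>u\<in>U. d u * a u s) = 0" if "s \<in> insert t T" for s
      using that c(2) unfolding d by (auto simp: mult.commute)
    ultimately show ?thesis by blast
  qed
qed

definition int_comb :: "('a, 'b) monoid_scheme \<Rightarrow> ('i \<Rightarrow> 'a) \<Rightarrow> ('i \<Rightarrow> int) \<Rightarrow> 'i set \<Rightarrow> 'a" where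
  "int_comb G g c I = finprod G (\<lambda>i. g i [^]\<^bsub>G\<^esub> c i) I"

context comm_group
begin

lemma int_comb_closed [simp]: "g \<in> I \<rightarrow> carrier G \<Longrightarrow> int_comb G g c I \<in> carrier G"
  unfolding int_comb_def by (intro finprod_closed) auto

lemma int_comb_cong:
  "\<lbrakk>g \<in> I \<rightarrow> carrier G; \<And>i. i \<in> I \<Longrightarrow> h i = g i; \<And>i. i \<in> I \<Longrightarrow> c i = d i\<rbrakk>
    \<Longrightarrow> int_comb G h c I = int_comb G g d I"
  unfolding int_comb_def by (intro finprod_cong) (auto simp: simp_implies_def Pi_iff)

lemma int_comb_insert:
  "\<lbrakk>finite I; i \<notin> I; g \<in> insert i I \<rightarrow> carrier G\<rbrakk>
    \<Longrightarrow> int_comb G g c (insert i I) = g i [^] c i \<otimes> int_comb G g c I"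
  unfolding int_comb_def by (subst finprod_insert) auto

lemma int_comb_Un:
  "\<lbrakk>finite I; finite J; I \<inter> J = {}; g \<in> I \<union> J \<rightarrow> carrier G\<rbrakk>
    \<Longrightarrow> int_comb G g c (I \<union> J) = int_comb G g c I \<otimes> int_comb G g c J"
  unfolding int_comb_def by (subst finprod_Un_disjoint) auto

lemma int_comb_zero: "(\<And>i. i \<in> I \<Longrightarrow> c i = 0) \<Longrightarrow> int_comb G g c I = \<one>"
  unfolding int_comb_def by (intro finprod_one_eqI) auto

lemma int_comb_add:
  assumes "g \<in> I \<rightarrow> carrier G"
  shows "int_comb G g (\<lambda>i. c i + d i) I = int_comb G g c I \<otimes> int_comb G g d I"
proof -
  have "int_comb G g (\<lambda>i. c i + d i) I = finprod G (\<lambda>i. g i [^] c i \<otimes> g i [^] d i) I"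
    unfolding int_comb_def using assms
    by (intro finprod_cong) (auto simp: simp_implies_def int_pow_mult Pi_iff)
  also have "\<dots> = int_comb G g c I \<otimes> int_comb G g d I"
    unfolding int_comb_def using assms by (intro finprod_multf) auto
  finally show ?thesis .
qed

lemma int_comb_pow:
  assumes "finite I" "g \<in> I \<rightarrow> carrier G"
  shows "int_comb G g c I [^] (k::int) = int_comb G g (\<lambda>i. k * c i) I"
  using assms
proof (induction I)
  case (insert i I)
  then show ?case
    by (simp add: int_comb_insert int_pow_distrib int_pow_pow mult.commute)
qed (simp add: int_comb_def)

lemma int_comb_int_comb:
  assumes "finite U" "finite T" "g \<in> T \<rightarrow> carrier G"
  shows "int_comb G (\<lambda>u. int_comb G g (a u) T) c U = int_comb G g (\<lambda>t. \<Sum>u\<in>U. c u * a u t) T"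
  using assms(1)
proof (induction U)
  case (insert u U)
  then show ?case using assms
    by (simp add: int_comb_insert int_comb_add int_comb_pow)
qed (simp add: int_comb_zero, simp add: int_comb_def)

lemma int_comb_reindex:
  "\<lbrakk>inj_on h I; g \<in> h ` I \<rightarrow> carrier G\<rbrakk> \<Longrightarrow> int_comb G g c (h ` I) = int_comb G (\<lambda>i. g (h i)) (\<lambda>i. c (h i)) I"
  unfolding int_comb_def by (subst finprod_reindex) auto

end

lemma int_independent_iff:
  "int_independent G S \<longleftrightarrow> finite S \<and> S \<subseteq> carrier G \<and>
     (\<forall>c. int_comb G (\<lambda>x. x) c S = \<one>\<^bsub>G\<^esub> \<longrightarrow> (\<forall>x\<in>S. c x = 0))"
  by (simp add: int_independent_def int_comb_def)

lemma int_independentD: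
  "\<lbrakk>int_independent G S; int_comb G (\<lambda>x. x) c S = \<one>\<^bsub>G\<^esub>; x \<in> S\<rbrakk> \<Longrightarrow> c x = 0"
  unfolding int_independent_iff by blast

lemma hom_int_comb:
  assumes "comm_group G" "comm_group H" "f \<in> hom G H" "finite I" "g \<in> I \<rightarrow> carrier G"
  shows "f (int_comb G g c I) = int_comb H (\<lambda>i. f (g i)) c I"
proof -
  interpret G: comm_group G by fact
  interpret H: comm_group H by fact
  interpret f: group_hom G H f by unfold_locales fact
  show ?thesis using assms(4,5)
  proof (induction I)
    case (insert i I)
    then show ?case
      by (subst G.int_comb_insert H.int_comb_insert; auto simp: f.hom_int_pow Pi_iff)+
  qed (simp add: int_comb_def)
qed

definition int_dependent_on :: "('a, 'b) monoid_scheme \<Rightarrow> 'a set \<Rightarrow> 'a \<Rightarrow> bool" where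
  "int_dependent_on G T x \<longleftrightarrow> (\<exists>n c. n \<noteq> 0 \<and> x [^]\<^bsub>G\<^esub> (n::int) = int_comb G (\<lambda>x. x) c T)"

context comm_group
begin

text \<open>The Steinitz exchange bound over the integers. If \<open>U\<close> were larger than \<open>T\<close>, an integer relation
  between the coefficient vectors of the multiples of the elements of \<open>U\<close> would be a nontrivial
  relation between these elements.\<close>

lemma int_independent_card_le:
  assumes U: "int_independent G U" and T: "finite T" "T \<subseteq> carrier G"
    and dep: "\<And>u. u \<in> U \<Longrightarrow> int_dependent_on G T u"
  shows "card U \<le> card T"
proof (rule ccontr)
  assume "\<not> card U \<le> card T"
  have fU: "finite U" "U \<subseteq> carrier G" using U by (auto simp: int_independent_def)
  obtain n a where na: "\<And>u. u \<in> U \<Longrightarrow> n u \<noteq> 0"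
    "\<And>u. u \<in> U \<Longrightarrow> u [^] (n u :: int) = int_comb G (\<lambda>x. x) (a u) T"
    using dep unfolding int_dependent_on_def by metis
  obtain c where c: "\<exists>u\<in>U. c u \<noteq> 0" "\<And>t. t \<in> T \<Longrightarrow> (\<Sum>u\<in>U. c u * a u t) = 0"
    using integer_homogeneous_system[OF T(1) fU(1), of a] \<open>\<not> card U \<le> card T\<close> by auto
  have id: "(\<lambda>x. x) \<in> T \<rightarrow> carrier G" "(\<lambda>x. x) \<in> U \<rightarrow> carrier G" using T fU by auto
  have "int_comb G (\<lambda>x. x) (\<lambda>u. n u * c u) U = int_comb G (\<lambda>u. u [^] n u) c U"
    unfolding int_comb_def using fU
    by (intro finprod_cong) (auto simp: simp_implies_def int_pow_pow)
  also have "\<dots> = int_comb G (\<lambda>u. int_comb G (\<lambda>x. x) (a u) T) c U"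
    using na(2) id by (intro int_comb_cong) auto
  also have "\<dots> = \<one>" using id c(2) fU T by (simp add: int_comb_int_comb int_comb_zero)
  finally have "\<forall>u\<in>U. n u * c u = 0" using U unfolding int_independent_iff by blast
  then show False using c(1) na(1) by auto
qed

lemma int_dependent_on_if_maximal:
  assumes S: "int_independent G S" and x: "x \<in> carrier G"
    and max: "x \<in> S \<or> \<not> int_independent G (insert x S)"
  shows "int_dependent_on G S x"
proof (cases "x \<in> S")
  case True
  have fS: "finite S" "(\<lambda>x. x) \<in> S \<rightarrow> carrier G" using S by (auto simp: int_independent_def)
  let ?c = "\<lambda>s. if s = x then 1 else (0::int)"
  have "int_comb G (\<lambda>x. x) ?c (insert x (S - {x})) = x [^] (1::int) \<otimes> int_comb G (\<lambda>x. x) ?c (S - {x})"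
    using fS x by (subst int_comb_insert) auto
  also have "int_comb G (\<lambda>x. x) ?c (S - {x}) = \<one>" by (rule int_comb_zero) auto
  finally have "x [^] (1::int) = int_comb G (\<lambda>x. x) ?c S" using True x by (simp add: insert_absorb)
  then show ?thesis unfolding int_dependent_on_def by (metis one_neq_zero)
next
  case False
  have fS: "finite S" "S \<subseteq> carrier G" using S by (auto simp: int_independent_def)
  obtain c where c: "int_comb G (\<lambda>x. x) c (insert x S) = \<one>" "\<exists>y\<in>insert x S. c y \<noteq> 0"
    using max False fS x unfolding int_independent_iff by auto
  have id: "(\<lambda>x. x) \<in> S \<rightarrow> carrier G" using fS by auto
  have eq: "x [^] c x \<otimes> int_comb G (\<lambda>x. x) c S = \<one>"
    using c(1) fS x False by (subst (asm) int_comb_insert) auto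
  have "c x \<noteq> 0"
  proof
    assume "c x = 0"
    with eq id have "int_comb G (\<lambda>x. x) c S = \<one>" by simp
    with S have "\<forall>y\<in>S. c y = 0" by (simp add: int_independent_iff)
    with \<open>c x = 0\<close> c(2) show False by auto
  qed
  moreover have "x [^] c x = int_comb G (\<lambda>x. x) (\<lambda>i. - 1 * c i) S"
  proof -
    have "int_comb G (\<lambda>x. x) (\<lambda>i. - 1 * c i) S = inv (int_comb G (\<lambda>x. x) c S)"
      using int_comb_pow[OF fS(1) id, of c "-1"] id by (simp add: int_pow_neg)
    also have "\<dots> = x [^] c x"
      using eq id x by (intro inv_equality) auto
    finally show ?thesis by simp
  qed
  ultimately show ?thesis unfolding int_dependent_on_def by blast
qed

end

text \<open>The rank is taken of a subset \<open>K\<close> of the carrier, so that kernels and images in an exact sequence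
  can be compared inside the ambient groups. It is a relation, because a supremum of natural numbers
  carries no information when the cardinalities are unbounded; the relation asserts that the maximum
  exists.\<close>

definition has_rank :: "('a, 'b) monoid_scheme \<Rightarrow> 'a set \<Rightarrow> nat \<Rightarrow> bool" where
  "has_rank G K k \<longleftrightarrow> (\<exists>S. int_independent G S \<and> S \<subseteq> K \<and> card S = k) \<and>
     (\<forall>S. int_independent G S \<and> S \<subseteq> K \<longrightarrow> card S \<le> k)"

lemma has_rank_abelian_rank:
  assumes "has_rank G (carrier G) k"
  shows "abelian_rank G = k"
proof -
  have "Sup (card ` {S. int_independent G S}) = k"
  proof (rule cSup_eq_maximum)
    show "k \<in> card ` {S. int_independent G S}" using assms by (auto simp: has_rank_def)
    show "x \<le> k" if "x \<in> card ` {S. int_independent G S}" for x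
      using that assms by (auto simp: has_rank_def int_independent_def)
  qed
  then show ?thesis by (simp add: abelian_rank_def)
qed

lemma has_rank_exists:
  assumes "\<And>S. int_independent G S \<Longrightarrow> S \<subseteq> K \<Longrightarrow> card S \<le> k"
  shows "\<exists>r. has_rank G K r"
proof -
  let ?C = "{c. \<exists>S. int_independent G S \<and> S \<subseteq> K \<and> card S = c}"
  have fin: "finite ?C" by (rule finite_subset[of _ "{..k}"]) (use assms in auto)
  have "int_independent G {}" by (simp add: int_independent_def)
  then have ne: "?C \<noteq> {}" by blast
  have "has_rank G K (Max ?C)"
    using Max_in[OF fin ne] Max_ge[OF fin] by (auto simp: has_rank_def)
  then show ?thesis ..
qed

lemma has_rank_subset:
  assumes "has_rank G K k" "K' \<subseteq> K"
  shows "\<exists>k'. has_rank G K' k'"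
  using assms by (intro has_rank_exists[of _ _ k]) (auto simp: has_rank_def)

lemma has_rank_unique: "has_rank G K k \<Longrightarrow> has_rank G K l \<Longrightarrow> k = l"
  unfolding has_rank_def by (metis le_antisym)

lemma int_independent_one_notin:
  assumes "comm_group G" "int_independent G S"
  shows "\<one>\<^bsub>G\<^esub> \<notin> S"
proof
  interpret comm_group G by fact
  assume one: "\<one>\<^bsub>G\<^esub> \<in> S"
  have eq: "finprod G (\<lambda>x. x [^]\<^bsub>G\<^esub> (if x = \<one>\<^bsub>G\<^esub> then 1 else 0 :: int)) S = \<one>\<^bsub>G\<^esub>"
    by (intro finprod_one_eqI) auto
  have "\<forall>x\<in>S. (if x = \<one>\<^bsub>G\<^esub> then 1 else 0 :: int) = 0"
    using assms(2)[unfolded int_independent_def, THEN conjunct2, THEN conjunct2, THEN spec,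
        THEN mp, OF eq] .
  then show False using one by auto
qed

lemma has_rank_trivial:
  assumes "comm_group G" "K \<subseteq> {\<one>\<^bsub>G\<^esub>}"
  shows "has_rank G K 0"
proof -
  have *: "S = {}" if "int_independent G S" "S \<subseteq> K" for S
    using int_independent_one_notin[OF assms(1) that(1)] that(2) assms(2) by blast
  have "int_independent G {}" by (simp add: int_independent_def)
  then have "\<exists>S. int_independent G S \<and> S \<subseteq> K \<and> card S = 0" by (intro exI[of _ "{}"]) simp
  then show ?thesis unfolding has_rank_def by (auto dest!: *)
qed

text \<open>Applying \<open>f\<close> to a relation between elements of \<open>S\<close> and lifts of elements of \<open>T\<close> kills the part in
  \<open>S\<close>, so the coefficients on \<open>T\<close> vanish by independence in \<open>H\<close>, and then those on \<open>S\<close>.\<close>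

lemma int_independent_lift:
  assumes G: "comm_group G" and H: "comm_group H" and f: "f \<in> hom G H"
    and S: "int_independent G S" "S \<subseteq> kernel G H f"
    and T: "int_independent H T" and g: "\<And>t. t \<in> T \<Longrightarrow> g t \<in> carrier G \<and> f (g t) = t"
  shows "int_independent G (S \<union> g ` T)" "card (S \<union> g ` T) = card S + card T"
proof -
  interpret G: comm_group G by fact
  interpret H: comm_group H by fact
  interpret f: group_hom G H f by unfold_locales fact
  have fin: "finite S" "finite T" "S \<subseteq> carrier G" "T \<subseteq> carrier H" 
    using S T by (auto simp: int_independent_def)
  have inj: "inj_on g T" by (metis g inj_onI)
  have disj: "S \<inter> g ` T = {}"
    using int_independent_one_notin[OF H T] g S(2) by (force simp: kernel_def)
  show "card (S \<union> g ` T) = card S + card T"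
    using fin disj inj by (simp add: card_Un_disjoint card_image)
  have car: "(\<lambda>x. x) \<in> S \<union> g ` T \<rightarrow> carrier G" "(\<lambda>x. x) \<in> S \<rightarrow> carrier G" "(\<lambda>x. x) \<in> g ` T \<rightarrow> carrier G"
    using fin g by auto
  show "int_independent G (S \<union> g ` T)"
    unfolding int_independent_iff
  proof (intro conjI allI impI)
    fix c assume c: "int_comb G (\<lambda>x. x) c (S \<union> g ` T) = \<one>\<^bsub>G\<^esub>"
    have split: "int_comb G (\<lambda>x. x) c (S \<union> g ` T) = int_comb G (\<lambda>x. x) c S \<otimes>\<^bsub>G\<^esub> int_comb G (\<lambda>x. x) c (g ` T)"
      using fin disj car by (intro G.int_comb_Un) auto
    have "f (int_comb G (\<lambda>x. x) c S) = int_comb H f c S"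
      using fin car by (intro hom_int_comb G H f) auto
    also have "\<dots> = int_comb H (\<lambda>_. \<one>\<^bsub>H\<^esub>) c S"
      using S(2) by (intro H.int_comb_cong) (auto simp: kernel_def)
    also have "\<dots> = \<one>\<^bsub>H\<^esub>" by (simp add: int_comb_def)
    finally have 1: "f (int_comb G (\<lambda>x. x) c S) = \<one>\<^bsub>H\<^esub>" .
    have "f (int_comb G (\<lambda>x. x) c (g ` T)) = int_comb H f c (g ` T)"
      using fin car by (intro hom_int_comb G H f) auto
    also have "\<dots> = int_comb H (\<lambda>t. f (g t)) (\<lambda>t. c (g t)) T"
      using inj g fin by (intro H.int_comb_reindex) auto
    also have "\<dots> = int_comb H (\<lambda>x. x) (\<lambda>t. c (g t)) T"
      using g fin by (intro H.int_comb_cong) auto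
    finally have 2: "f (int_comb G (\<lambda>x. x) c (g ` T)) = int_comb H (\<lambda>x. x) (\<lambda>t. c (g t)) T" .
    have "f (int_comb G (\<lambda>x. x) c (S \<union> g ` T)) = \<one>\<^bsub>H\<^esub>" using c by simp
    then have "int_comb H (\<lambda>x. x) (\<lambda>t. c (g t)) T = \<one>\<^bsub>H\<^esub>"
      unfolding split using car 1 2 fin by (simp add: Pi_iff subset_iff)
    from int_independentD[OF T this] have T0: "\<forall>t\<in>T. c (g t) = 0" by blast
    then have "int_comb G (\<lambda>x. x) c (g ` T) = \<one>\<^bsub>G\<^esub>" by (intro G.int_comb_zero) auto
    then have "int_comb G (\<lambda>x. x) c S = \<one>\<^bsub>G\<^esub>" using c split car by simp
    then have "\<forall>s\<in>S. c s = 0" using S by (simp add: int_independent_iff)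
    with T0 show "\<forall>x\<in>S \<union> g ` T. c x = 0" by auto
  qed (use fin g in auto)
qed

text \<open>Rank-nullity. The lifted set of the preceding lemma is independent, and it is as large as possible:
  a multiple of \<open>f u\<close> is a combination of \<open>T\<close>, so the corresponding multiple of \<open>u\<close> differs from a
  combination of the lifts by an element of the kernel, of which a further multiple is a combination
  of \<open>S\<close>.\<close>

lemma has_rank_kernel_image:
  assumes G: "comm_group G" and H: "comm_group H" and f: "f \<in> hom G H"
    and k: "has_rank G (kernel G H f) k" and l: "has_rank H (f ` carrier G) l"
  shows "has_rank G (carrier G) (k + l)"
proof -
  interpret G: comm_group G by fact
  interpret H: comm_group H by fact
  interpret f: group_hom G H f by unfold_locales fact
  obtain S where S: "int_independent G S" "S \<subseteq> kernel G H f" "card S = k"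
    using k by (auto simp: has_rank_def)
  obtain T where T: "int_independent H T" "T \<subseteq> f ` carrier G" "card T = l"
    using l by (auto simp: has_rank_def)
  have "\<forall>t\<in>T. \<exists>x. x \<in> carrier G \<and> f x = t" using T(2) by auto
  then obtain g where g: "\<And>t. t \<in> T \<Longrightarrow> g t \<in> carrier G \<and> f (g t) = t" by metis
  note lift = int_independent_lift[OF G H f S(1,2) T(1) g]
  have fin: "finite S" "finite T" "S \<subseteq> carrier G" "T \<subseteq> carrier H"
    using S T by (auto simp: int_independent_def)
  have inj: "inj_on g T" by (metis g inj_onI)
  have disj: "S \<inter> g ` T = {}"
    using int_independent_one_notin[OF H T(1)] g S(2) by (force simp: kernel_def)
  have car: "(\<lambda>x. x) \<in> S \<union> g ` T \<rightarrow> carrier G" "(\<lambda>x. x) \<in> S \<rightarrow> carrier G" "g \<in> T \<rightarrow> carrier G"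
    "(\<lambda>x. x) \<in> g ` T \<rightarrow> carrier G" "(\<lambda>x. x) \<in> T \<rightarrow> carrier H"
    using fin g by auto
  have dep: "int_dependent_on G (S \<union> g ` T) u" if u: "u \<in> carrier G" for u
  proof -
    have "int_dependent_on H T (f u)"
    proof (rule H.int_dependent_on_if_maximal[OF T(1)])
      show "f u \<in> T \<or> \<not> int_independent H (insert (f u) T)"
      proof (rule ccontr)
        assume "\<not> ?thesis"
        then have "int_independent H (insert (f u) T)" "f u \<notin> T" by auto
        moreover have "insert (f u) T \<subseteq> f ` carrier G" using u T by auto
        ultimately have "card (insert (f u) T) \<le> l" using l by (auto simp: has_rank_def)
        then show False using T(3) \<open>f u \<notin> T\<close> fin by simp
      qed
    qed (use u in auto)
    then obtain n a where na: "n \<noteq> 0" "f u [^]\<^bsub>H\<^esub> (n::int) = int_comb H (\<lambda>x. x) a T"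
      unfolding int_dependent_on_def by blast
    define y where "y = u [^]\<^bsub>G\<^esub> n \<otimes>\<^bsub>G\<^esub> int_comb G g (\<lambda>t. - 1 * a t) T"
    have yc: "y \<in> carrier G" using u car by (simp add: y_def)
    have pow: "int_comb G g (\<lambda>t. - 1 * a t) T = inv\<^bsub>G\<^esub> (int_comb G g a T)"
      using fin car G.int_comb_pow[of T g a "-1"] by (simp add: G.int_pow_neg)
    have "f (int_comb G g a T) = int_comb H (\<lambda>i. f (g i)) a T"
      using fin car by (intro hom_int_comb G H f) auto
    also have "\<dots> = int_comb H (\<lambda>x. x) a T"
      using g fin by (intro H.int_comb_cong) auto
    finally have "f y = \<one>\<^bsub>H\<^esub>"
      unfolding y_def pow using u na(2) car by (simp add: f.hom_int_pow)
    then have yk: "y \<in> kernel G H f" using yc by (simp add: kernel_def)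
    have "int_dependent_on G S y"
    proof (rule G.int_dependent_on_if_maximal[OF S(1) yc])
      show "y \<in> S \<or> \<not> int_independent G (insert y S)"
      proof (rule ccontr)
        assume "\<not> ?thesis"
        then have "int_independent G (insert y S)" "y \<notin> S" by auto
        moreover have "insert y S \<subseteq> kernel G H f" using yk S by auto
        ultimately have "card (insert y S) \<le> k" using k by (auto simp: has_rank_def)
        then show False using S(3) \<open>y \<notin> S\<close> fin by simp
      qed
    qed
    then obtain m b where mb: "m \<noteq> 0" "y [^]\<^bsub>G\<^esub> (m::int) = int_comb G (\<lambda>x. x) b S"
      unfolding int_dependent_on_def by blast
    have "u [^]\<^bsub>G\<^esub> n = y \<otimes>\<^bsub>G\<^esub> int_comb G g a T"
      unfolding y_def pow using u car by (simp add: G.m_assoc)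
    then have "u [^]\<^bsub>G\<^esub> (n * m) = y [^]\<^bsub>G\<^esub> m \<otimes>\<^bsub>G\<^esub> int_comb G g a T [^]\<^bsub>G\<^esub> m"
      using u yc car by (simp add: G.int_pow_distrib flip: G.int_pow_pow)
    also have "int_comb G g a T [^]\<^bsub>G\<^esub> m = int_comb G g (\<lambda>t. m * a t) T"
      using fin car by (intro G.int_comb_pow) auto
    also have "\<dots> = int_comb G (\<lambda>x. x) (\<lambda>x. m * a (f x)) (g ` T)"
      using inj g fin car by (subst G.int_comb_reindex) (auto intro!: G.int_comb_cong)
    finally have eq: "u [^]\<^bsub>G\<^esub> (n * m)
      = int_comb G (\<lambda>x. x) b S \<otimes>\<^bsub>G\<^esub> int_comb G (\<lambda>x. x) (\<lambda>x. m * a (f x)) (g ` T)"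
      by (simp add: mb(2))
    let ?c = "\<lambda>x. if x \<in> S then b x else m * a (f x)"
    have "int_comb G (\<lambda>x. x) ?c (S \<union> g ` T) = int_comb G (\<lambda>x. x) ?c S \<otimes>\<^bsub>G\<^esub> int_comb G (\<lambda>x. x) ?c (g ` T)"
      using fin disj car by (intro G.int_comb_Un) auto
    also have "int_comb G (\<lambda>x. x) ?c S = int_comb G (\<lambda>x. x) b S"
      using car by (intro G.int_comb_cong) auto
    also have "int_comb G (\<lambda>x. x) ?c (g ` T) = int_comb G (\<lambda>x. x) (\<lambda>x. m * a (f x)) (g ` T)"
      using car disj by (intro G.int_comb_cong) auto
    finally have "u [^]\<^bsub>G\<^esub> (n * m) = int_comb G (\<lambda>x. x) ?c (S \<union> g ` T)" by (simp add: eq)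
    moreover have "n * m \<noteq> 0" using na mb by simp
    ultimately show ?thesis unfolding int_dependent_on_def by blast
  qed
  have "card U \<le> k + l" if "int_independent G U" for U
  proof -
    have "card U \<le> card (S \<union> g ` T)"
      using that fin g dep
      by (intro G.int_independent_card_le) (auto simp: int_independent_def)
    then show ?thesis using lift(2) S(3) T(3) by simp
  qed
  moreover have "card (S \<union> g ` T) = k + l" using lift(2) S(3) T(3) by simp
  moreover have "S \<union> g ` T \<subseteq> carrier G" using fin g by auto
  ultimately show ?thesis
    unfolding has_rank_def using lift(1) by blast
qed

lemma has_rank_image:
  assumes G: "comm_group G" and H: "comm_group H" and f: "f \<in> hom G H"
    and k: "has_rank G (carrier G) k"
  shows "\<exists>l. has_rank H (f ` carrier G) l"
proof (rule has_rank_exists)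
  fix T assume T: "int_independent H T" "T \<subseteq> f ` carrier G"
  then have "\<forall>t\<in>T. \<exists>x. x \<in> carrier G \<and> f x = t" by auto
  then obtain g where g: "\<And>t. t \<in> T \<Longrightarrow> g t \<in> carrier G \<and> f (g t) = t" by metis
  have "int_independent G {}" by (simp add: int_independent_def)
  note lift = int_independent_lift[OF G H f this empty_subsetI T(1) g]
  have "{} \<union> g ` T \<subseteq> carrier G" using g by auto
  then have "card ({} \<union> g ` T) \<le> k"
    using k lift(1) unfolding has_rank_def by blast
  then show "card T \<le> k" using lift(2) by simp
qed

lemma has_rank_iso:
  assumes G: "comm_group G" and H: "comm_group H" and iso: "G \<cong> H"
    and k: "has_rank H (carrier H) k"
  shows "has_rank G (carrier G) k"
proof -
  interpret G: comm_group G by fact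
  interpret H: comm_group H by fact
  obtain f where f: "f \<in> iso G H" using iso by (auto simp: is_iso_def)
  then have hom: "f \<in> hom G H" and im: "f ` carrier G = carrier H"
    and inj: "inj_on f (carrier G)"
    by (auto simp: iso_def bij_betw_def)
  interpret f: group_hom G H f by unfold_locales fact
  have "kernel G H f \<subseteq> {\<one>\<^bsub>G\<^esub>}"
    using inj f.inj_iff_trivial_ker by auto
  then have "has_rank G (carrier G) (0 + k)"
    using k im by (intro has_rank_kernel_image[OF G H hom] has_rank_trivial[OF G]) auto
  then show ?thesis by simp
qed

lemma has_rank_integer_group: "has_rank integer_group (carrier integer_group) 1"
proof -
  interpret comm_group integer_group by (rule abelian_integer_group)
  have pow: "x [^]\<^bsub>integer_group\<^esub> (n::int) = n * x" for x n by simp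
  have 1: "int_independent integer_group {1}"
    unfolding int_independent_def by (auto simp: finprod_insert)
  have dep: "int_dependent_on integer_group {1} u" for u
    unfolding int_dependent_on_def
    by (rule exI[of _ 1], rule exI[of _ "\<lambda>_. u"]) (simp add: int_comb_def)
  have "card S \<le> 1" if "int_independent integer_group S" for S
    using int_independent_card_le[OF that, of "{1}"] dep by simp
  then show ?thesis using 1 by (auto simp: has_rank_def intro!: exI[of _ "{1}"])
qed

section \<open>Euler characteristics of pairs\<close>

text \<open>Finiteness of the ranks is part of the relation and is transported along with the value \<open>e\<close>, since
  \<open>euler_characteristic\<close> is meaningless without it.\<close>

definition has_euler :: "'a topology \<Rightarrow> 'a set \<Rightarrow> int \<Rightarrow> bool" where
  "has_euler X S e \<longleftrightarrow> (\<exists>r P.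
     (\<forall>p. has_rank (relative_homology_group (int p) X S)
            (carrier (relative_homology_group (int p) X S)) (r p)) \<and>
     (\<forall>p\<ge>P. r p = 0) \<and> e = (\<Sum>p<P. (-1) ^ p * int (r p)))"

lemma alternating_sum_extend:
  fixes r :: "nat \<Rightarrow> nat"
  assumes "\<And>p. p \<ge> P \<Longrightarrow> r p = 0" "P \<le> Q"
  shows "(\<Sum>p<P. (-1) ^ p * int (r p)) = (\<Sum>p<Q. (-1) ^ p * int (r p))"
  by (rule sum.mono_neutral_left) (use assms in auto)

lemma euler_characteristic_eq:
  assumes "has_euler X {} e"
  shows "euler_characteristic X = e"
proof -
  obtain r P where r: "\<And>p. has_rank (homology_group (int p) X) (carrier (homology_group (int p) X)) (r p)"
    "\<And>p. p \<ge> P \<Longrightarrow> r p = 0" and e: "e = (\<Sum>p<P. (-1) ^ p * int (r p))"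
    using assms unfolding has_euler_def by blast
  have "betti p X = r p" for p
    unfolding betti_def by (rule has_rank_abelian_rank[OF r(1)])
  then have "euler_characteristic X = (\<Sum>p | r p \<noteq> 0. (-1) ^ p * int (r p))"
    by (simp add: euler_characteristic_def)
  also have "\<dots> = (\<Sum>p<P. (-1) ^ p * int (r p))"
  proof (rule sum.mono_neutral_left)
    show "{p. r p \<noteq> 0} \<subseteq> {..<P}" using r(2) by (metis (mono_tags, lifting) lessThan_iff mem_Collect_eq not_le subsetI)
  qed auto
  finally show ?thesis using e by simp
qed

lemma has_euler_iso:
  assumes "has_euler Y T e"
    and "\<And>p. relative_homology_group p X S \<cong> relative_homology_group p Y T"
  shows "has_euler X S e"
proof -
  obtain r P where r: "\<And>p. has_rank (relative_homology_group (int p) Y T)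
            (carrier (relative_homology_group (int p) Y T)) (r p)"
    "\<And>p. p \<ge> P \<Longrightarrow> r p = 0" and e: "e = (\<Sum>p<P. (-1) ^ p * int (r p))"
    using assms(1) unfolding has_euler_def by blast
  have "has_rank (relative_homology_group (int p) X S)
            (carrier (relative_homology_group (int p) X S)) (r p)" for p
    by (rule has_rank_iso[OF abelian_relative_homology_group abelian_relative_homology_group assms(2) r(1)])
  then show ?thesis unfolding has_euler_def using r(2) e by blast
qed

lemma has_euler_empty:
  assumes "topspace X = {}"
  shows "has_euler X {} 0"
proof -
  have "has_rank (homology_group (int p) X) (carrier (homology_group (int p) X)) 0" for p
    using trivial_homology_group_empty[OF assms, of "int p"]
    by (intro has_rank_trivial abelian_homology_group) (auto simp: trivial_group_def)
  then show ?thesis unfolding has_euler_def by (intro exI[of _ "\<lambda>_. 0"] exI[of _ 0]) auto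
qed

text \<open>In the long exact sequence of the pair, let \<open>a\<close>, \<open>b\<close>, \<open>c\<close> be the ranks of the images of the maps
  out of \<open>H(S)\<close>, \<open>H(X)\<close>, \<open>H(X,S)\<close>. Rank-nullity gives \<open>y p = c (p+1) + a p\<close>, \<open>x p = b p + c p\<close> and
  \<open>a p + b p\<close> for the three groups, and the contributions of \<open>c\<close> to the alternating sum telescope.
  The finiteness of the homology of \<open>X\<close> comes out of the same count.\<close>

lemma has_euler_exact:
  assumes Y: "has_euler (subtopology X S) {} d" and XS: "has_euler X S e"
  shows "has_euler X {} (d + e)"
proof -
  let ?Y = "subtopology X S"
  let ?HY = "\<lambda>p. homology_group p ?Y"
  let ?HX = "\<lambda>p. homology_group p X"
  let ?HR = "\<lambda>p. relative_homology_group p X S"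
  let ?f = "\<lambda>p. hom_induced p ?Y {} X {} id"
  let ?g = "\<lambda>p. hom_induced p X {} X S id"
  let ?d = "\<lambda>p. hom_boundary p X S"
  obtain y P1 where y: "\<And>p. has_rank (?HY (int p)) (carrier (?HY (int p))) (y p)"
    "\<And>p. p \<ge> P1 \<Longrightarrow> y p = 0" and d: "d = (\<Sum>p<P1. (-1) ^ p * int (y p))"
    using Y unfolding has_euler_def by blast
  obtain x P2 where x: "\<And>p. has_rank (?HR (int p)) (carrier (?HR (int p))) (x p)"
    "\<And>p. p \<ge> P2 \<Longrightarrow> x p = 0" and e: "e = (\<Sum>p<P2. (-1) ^ p * int (x p))"
    using XS unfolding has_euler_def by blast
  have cY: "comm_group (?HY p)" and cX: "comm_group (?HX p)" and cR: "comm_group (?HR p)" for p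
    by (rule abelian_relative_homology_group)+
  have hf: "?f p \<in> hom (?HY p) (?HX p)" and hg: "?g p \<in> hom (?HX p) (?HR p)"
    and hd: "?d p \<in> hom (?HR p) (?HY (p - 1))" for p
    by (rule hom_induced_hom hom_boundary_hom)+
  have k1: "?g p ` carrier (?HX p) = kernel (?HR p) (?HY (p - 1)) (?d p)" for p
    using homology_exactness_axiom_1[of p X S] by simp
  have k2: "?d p ` carrier (?HR p) = kernel (?HY (p - 1)) (?HX (p - 1)) (?f (p - 1))" for p
    using homology_exactness_axiom_2[of p X S] by simp
  have k3: "?f p ` carrier (?HY p) = kernel (?HX p) (?HR p) (?g p)" for p
    using homology_exactness_axiom_3[of p X S] by simp
  have "\<forall>p. \<exists>a. has_rank (?HX (int p)) (?f (int p) ` carrier (?HY (int p))) a"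
    using has_rank_image[OF cY cX hf y(1)] by blast
  then obtain a where a: "\<And>p. has_rank (?HX (int p)) (?f (int p) ` carrier (?HY (int p))) (a p)"
    by metis
  have "\<forall>p. \<exists>c. has_rank (?HY (int p - 1)) (?d (int p) ` carrier (?HR (int p))) c"
    using has_rank_image[OF cR cY hd x(1)] by blast
  then obtain c where c: "\<And>p. has_rank (?HY (int p - 1)) (?d (int p) ` carrier (?HR (int p))) (c p)"
    by metis
  have "\<forall>p. \<exists>b. has_rank (?HR (int p)) (?g (int p) ` carrier (?HX (int p))) b"
  proof
    fix p
    have "?g (int p) ` carrier (?HX (int p)) \<subseteq> carrier (?HR (int p))"
      using hg by (auto simp: hom_def)
    then show "\<exists>b. has_rank (?HR (int p)) (?g (int p) ` carrier (?HX (int p))) b"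
      by (rule has_rank_subset[OF x(1)])
  qed
  then obtain b where b: "\<And>p. has_rank (?HR (int p)) (?g (int p) ` carrier (?HX (int p))) (b p)"
    by metis
  have xeq: "x p = b p + c p" for p
    using has_rank_kernel_image[OF cR cY hd b[unfolded k1] c] has_rank_unique[OF x(1)] by blast
  have yeq: "y p = c (Suc p) + a p" for p
  proof -
    have "has_rank (?HY (int p)) (kernel (?HY (int p)) (?HX (int p)) (?f (int p))) (c (Suc p))"
      using c[of "Suc p", unfolded k2] by simp
    from has_rank_kernel_image[OF cY cX hf this a] show ?thesis
      using has_rank_unique[OF y(1)] by blast
  qed
  have HX: "has_rank (?HX (int p)) (carrier (?HX (int p))) (a p + b p)" for p
    using has_rank_kernel_image[OF cX cR hg a[unfolded k3] b] .
  have c0: "c 0 = 0"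
  proof -
    have tr: "carrier (?HY (int 0 - 1)) = {\<one>\<^bsub>?HY (int 0 - 1)\<^esub>}"
      using trivial_relative_homology_group[of "-1" ?Y "{}"] by (simp add: trivial_group_def)
    have "?d (int 0) ` carrier (?HR (int 0)) \<subseteq> carrier (?HY (int 0 - 1))"
      using hd[of "int 0"] unfolding hom_def by blast
    then show ?thesis
      using has_rank_unique[OF c has_rank_trivial[OF cY]] tr by metis
  qed
  define Q where "Q = max P1 P2"
  have zero: "a p = 0" "b p = 0" "c p = 0" if "p \<ge> Q" for p
    using that xeq[of p] yeq[of p] x(2)[of p] y(2)[of p] by (auto simp: Q_def)
  have tele: "(\<Sum>p<n. (-1) ^ p * (int (c p) + int (c (Suc p)))) = int (c 0) - (-1) ^ n * int (c n)" for n
    by (induction n) (auto simp: algebra_simps)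
  have "d + e = (\<Sum>p<Q. (-1) ^ p * int (y p)) + (\<Sum>p<Q. (-1) ^ p * int (x p))"
    unfolding d e Q_def
    by (intro arg_cong2[where f = "(+)"] alternating_sum_extend y(2) x(2)) simp_all
  also have "\<dots> = (\<Sum>p<Q. (-1) ^ p * int (a p + b p))
      + (\<Sum>p<Q. (-1) ^ p * (int (c p) + int (c (Suc p))))"
    by (simp add: xeq yeq algebra_simps sum.distrib)
  also have "(\<Sum>p<Q. (-1) ^ p * (int (c p) + int (c (Suc p)))) = 0"
    using tele[of Q] c0 zero(3)[of Q] by simp
  finally have "d + e = (\<Sum>p<Q. (-1) ^ p * int (a p + b p))" by simp
  then show ?thesis unfolding has_euler_def
    using HX zero by (intro exI[of _ "\<lambda>p. a p + b p"] exI[of _ Q]) auto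
qed

text \<open>The suspension isomorphism \<open>H\<^sub>p(\<real>\<^sup>0, \<real>\<^sup>0 - 0) \<cong> H\<^sub>p\<^sub>+\<^sub>N(\<real>\<^sup>N, \<real>\<^sup>N - 0)\<close> reduces the computation to
  the homology of a point.\<close>

lemma has_euler_Euclidean_punctured:
  "has_euler (Euclidean_space N) (topspace (Euclidean_space N) - {\<lambda>_. 0}) ((-1) ^ N)"
proof -
  let ?R = "\<lambda>p. relative_homology_group p (Euclidean_space N) (topspace (Euclidean_space N) - {\<lambda>_. 0})"
  have top0: "topspace (Euclidean_space 0) = {\<lambda>_. 0}"
    by (auto simp: topspace_Euclidean_space)
  have "closedin (Euclidean_space 0) {\<lambda>_. 0}"
    by (metis top0 closedin_topspace)
  from relative_homology_group_Euclidean_complement_step[OF this, of _ N]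
  have step: "homology_group (p - int N) (Euclidean_space 0) \<cong> ?R p" for p
    unfolding top0 by (metis Diff_cancel add_0 diff_add_cancel)
  have iso: "?R p \<cong> homology_group (p - int N) (Euclidean_space 0)" for p
    by (rule group.iso_sym[OF group_relative_homology_group step])
  have "has_rank (?R (int p)) (carrier (?R (int p))) (if p = N then 1 else 0)" for p
  proof (rule has_rank_iso[OF abelian_relative_homology_group abelian_homology_group iso])
    let ?H = "homology_group (int p - int N) (Euclidean_space 0)"
    show "has_rank ?H (carrier ?H) (if p = N then 1 else 0)"
    proof (cases "p = N")
      case True
      then have "?H \<cong> integer_group" using homology_coefficients[OF top0] by simp
      from has_rank_iso[OF abelian_homology_group abelian_integer_group this has_rank_integer_group]
      show ?thesis using True by simp
    next
      case False
      then have "trivial_group ?H" by (intro homology_dimension_axiom[OF top0]) auto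
      then show ?thesis using False
        by (auto intro!: has_rank_trivial[OF abelian_homology_group] simp: trivial_group_def)
    qed
  qed
  moreover have "(-1) ^ N = (\<Sum>p<Suc N. (-1) ^ p * int (if p = N then 1 else 0))" by simp
  ultimately show ?thesis unfolding has_euler_def
    by (intro exI[of _ "\<lambda>p. if p = N then 1 else 0"] exI[of _ "Suc N"]) auto
qed

section \<open>Attaching one cell\<close>

lemma excision_at_point:
  assumes "t1_space P" "closedin P Y" "c \<in> topspace P - Y"
  shows "relative_homology_group p P (topspace P - {c})
    \<cong> relative_homology_group p (subtopology P (topspace P - Y)) (topspace P - Y - {c})"
proof -
  have "closedin P {c}" using assms by (auto simp: closedin_t1_singleton)
  then have "openin P (topspace P - {c})" by (simp add: closedin_def)
  then have "P interior_of (topspace P - {c}) = topspace P - {c}" by (simp add: interior_of_openin)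
  moreover have "P closure_of Y = Y" "Y \<subseteq> topspace P"
    using assms(2) by (auto simp: closure_of_closedin closedin_subset)
  ultimately have "P closure_of Y \<subseteq> P interior_of (topspace P - {c})" using assms(3) by auto
  from homology_excision_axiom[OF this Diff_subset, of p]
  have "relative_homology_group p (subtopology P (topspace P - Y)) (topspace P - {c} - Y)
      \<cong> relative_homology_group p P (topspace P - {c})"
    by (auto simp: is_iso_def)
  from group.iso_sym[OF group_relative_homology_group this]
  moreover have "topspace P - {c} - Y = topspace P - Y - {c}" by auto
  ultimately show ?thesis by simp
qed

text \<open>Removing the centre of a cell does not change the homotopy type of what the cell is attached to:
  the deformation \<open>h\<close> of the punctured model \<open>D - {c}\<close> onto its boundary descends along \<open>\<phi>\<close> to a
  deformation \<open>H\<close> of \<open>X - {\<phi> c}\<close> onto \<open>Y\<close>. It is continuous because \<open>\<phi>\<close> is proper, hence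
  \<open>id \<times> \<phi>\<close> is a closed map: the preimage of a closed set under \<open>H\<close> is the union of a closed
  part over \<open>Y\<close> and the image of a closed set of \<open>[0,1] \<times> (D - {c})\<close>.\<close>

lemma homology_attach_cell_punctured:
  fixes D :: "'d topology" and X :: "'a topology"
  assumes X: "Hausdorff_space X" and D: "compact_space D" and phi: "continuous_map D X \<phi>"
    and Y: "closedin X Y" and U: "U \<subseteq> topspace D" and bij: "bij_betw \<phi> U (topspace X - Y)"
    and bd: "\<phi> ` (topspace D - U) \<subseteq> Y" and c: "c \<in> U"
    and h: "continuous_map (prod_topology (top_of_set {0..1::real}) (subtopology D (topspace D - {c})))
      (subtopology D (topspace D - {c})) h"
    and h0: "\<And>x. x \<in> topspace D - {c} \<Longrightarrow> h (0, x) = x"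
    and h1: "\<And>x. x \<in> topspace D - {c} \<Longrightarrow> h (1, x) \<notin> U"
    and hbd: "\<And>t x. \<lbrakk>t \<in> {0..1}; x \<in> topspace D - U\<rbrakk> \<Longrightarrow> h (t, x) = x"
  shows "homology_group p (subtopology X (topspace X - {\<phi> c})) \<cong> homology_group p (subtopology X Y)"
proof -
  let ?I = "top_of_set {0..1::real}"
  define Z where "Z = subtopology X (topspace X - {\<phi> c})"
  define D' where "D' = subtopology D (topspace D - {c})"
  have tZ: "topspace Z = topspace X - {\<phi> c}" and tD: "topspace D' = topspace D - {c}"
    by (auto simp: Z_def D'_def)
  have YX: "Y \<subseteq> topspace X" using Y by (rule closedin_subset)
  have inj: "inj_on \<phi> U" and im: "\<phi> ` U = topspace X - Y" using bij by (auto simp: bij_betw_def)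
  have cY: "\<phi> c \<notin> Y" using im c by auto
  have YZ: "Y \<subseteq> topspace Z" using YX cY by (auto simp: tZ)
  have phiX: "\<phi> d \<in> topspace X" if "d \<in> topspace D" for d
    using phi that by (auto simp: continuous_map_def)
  have phi_c: "d = c" if "d \<in> topspace D" "\<phi> d = \<phi> c" for d
  proof (cases "d \<in> U")
    case True
    then show ?thesis using that(2) c by (simp add: inj_onD[OF inj])
  next
    case False
    then have "\<phi> d \<in> Y" using that(1) bd by auto
    then show ?thesis using that(2) cY by simp
  qed
  have pm: "proper_map D X \<phi>"
    using D X phi by (simp add: continuous_imp_proper_map Hausdorff_imp_kc_space)
  have "{d \<in> topspace D. \<phi> d \<in> topspace X - {\<phi> c}} = topspace D - {c}"
    using phiX phi_c by auto
  from proper_map_restriction[OF pm this] have pm': "proper_map D' Z \<phi>"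
    by (simp add: D'_def Z_def)
  have cont': "continuous_map D' Z \<phi>"
    unfolding Z_def D'_def using phi phiX phi_c
    by (auto simp: continuous_map_in_subtopology continuous_map_from_subtopology)
  let ?F = "\<lambda>(t, d). (id t, \<phi> d)"
  have closed_F: "closed_map (prod_topology ?I D') (prod_topology ?I Z) ?F"
    using pm' by (intro proper_imp_closed_map) (simp add: proper_map_prod del: id_apply)
  define H where "H = (\<lambda>(t, x). if x \<in> Y then x else \<phi> (h (t, inv_into U \<phi> x)))"
  \<comment> \<open>On points of the boundary of \<open>D\<close> both branches of \<open>H\<close> agree, as \<open>h\<close> fixes them.\<close>
  have HF: "H (t, \<phi> d) = \<phi> (h (t, d))" if "t \<in> {0..1}" "d \<in> topspace D - {c}" for t d
  proof (cases "d \<in> U")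
    case True
    then have "\<phi> d \<notin> Y" using im by auto
    then show ?thesis using True inj by (simp add: H_def)
  next
    case False
    then have "\<phi> d \<in> Y" "h (t, d) = d" using bd hbd that by auto
    then show ?thesis by (simp add: H_def)
  qed
  have ex: "\<exists>d \<in> topspace D - {c}. x = \<phi> d" if "x \<in> topspace Z - Y" for x
  proof -
    have "x \<in> \<phi> ` U" "x \<noteq> \<phi> c" using that im by (auto simp: tZ)
    then show ?thesis using U by auto
  qed
  have h_in: "h (t, d) \<in> topspace D - {c}" if "t \<in> {0..1}" "d \<in> topspace D - {c}" for t d
  proof -
    have "(t, d) \<in> topspace (prod_topology ?I (subtopology D (topspace D - {c})))"
      using that by auto
    then have "h (t, d) \<in> topspace (subtopology D (topspace D - {c}))"
      using h unfolding continuous_map_def by blast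
    then show ?thesis by auto
  qed
  have phiZ: "\<phi> d \<in> topspace Z" if "d \<in> topspace D - {c}" for d
    using that phiX phi_c by (auto simp: tZ)
  have H_in: "H (t, x) \<in> topspace Z" if tx: "t \<in> {0..1}" "x \<in> topspace Z" for t x
  proof (cases "x \<in> Y")
    case True then show ?thesis using tx by (simp add: H_def)
  next
    case False
    then obtain d where d: "d \<in> topspace D - {c}" "x = \<phi> d" using ex tx by blast
    then show ?thesis using HF[OF tx(1) d(1)] phiZ[OF h_in[OF tx(1) d(1)]] by simp
  qed
  have cont_H: "continuous_map (prod_topology ?I Z) Z H"
    unfolding continuous_map_closedin
  proof (intro conjI allI impI)
    show "H \<in> topspace (prod_topology ?I Z) \<rightarrow> topspace Z" using H_in by auto
  next
    fix C assume C: "closedin Z C"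
    have "continuous_map (prod_topology ?I D') Z (\<phi> \<circ> h)"
      using continuous_map_compose[OF h[folded D'_def] cont'] .
    then have "closedin (prod_topology ?I D') {z \<in> topspace (prod_topology ?I D'). (\<phi> \<circ> h) z \<in> C}"
      using C by (rule closedin_continuous_map_preimage)
    with closed_F have 1: "closedin (prod_topology ?I Z)
        (?F ` {z \<in> topspace (prod_topology ?I D'). (\<phi> \<circ> h) z \<in> C})"
      unfolding closed_map_def by blast
    have "closedin Z Y" unfolding Z_def using Y YZ unfolding tZ
      by (intro closedin_subset_topspace)
    then have 2: "closedin (prod_topology ?I Z) ({0..1} \<times> (Y \<inter> C))"
      using C by (auto simp: closedin_prod_Times_iff closedin_Int)
    have "{z \<in> topspace (prod_topology ?I Z). H z \<in> C}
      = {0..1} \<times> (Y \<inter> C) \<union> ?F ` {z \<in> topspace (prod_topology ?I D'). (\<phi> \<circ> h) z \<in> C}"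
      (is "?L = ?A \<union> ?B")
    proof
      show "?L \<subseteq> ?A \<union> ?B"
      proof
        fix z assume z: "z \<in> ?L"
        obtain t x where tx: "z = (t, x)" by (cases z)
        then have t: "t \<in> {0..1}" and x: "x \<in> topspace Z" and HC: "H (t, x) \<in> C" using z by auto
        show "z \<in> ?A \<union> ?B"
        proof (cases "x \<in> Y")
          case True
          then show ?thesis using HC t by (simp add: tx H_def)
        next
          case False
          then obtain d where d: "d \<in> topspace D - {c}" "x = \<phi> d" using ex x by blast
          then have "(t, d) \<in> {z \<in> topspace (prod_topology ?I D'). (\<phi> \<circ> h) z \<in> C}"
            using t HC HF[OF t d(1)] by (simp add: tD)
          then have "?F (t, d) \<in> ?B" by (rule imageI)
          then show ?thesis using d by (simp add: tx)
        qed
      qed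
      have "?A \<subseteq> ?L" using YZ by (auto simp: H_def)
      moreover have "?B \<subseteq> ?L" using phiZ HF by (auto simp: tD)
      ultimately show "?A \<union> ?B \<subseteq> ?L" by blast
    qed
    with 1 2 show "closedin (prod_topology ?I Z) {z \<in> topspace (prod_topology ?I Z). H z \<in> C}"
      by (simp only: closedin_Un)
  qed
  define r where "r x = H (1, x)" for x
  have H0: "H (0, x) = x" if x: "x \<in> topspace Z" for x
  proof (cases "x \<in> Y")
    case False
    then obtain d where d: "d \<in> topspace D - {c}" "x = \<phi> d" using ex x by blast
    then show ?thesis using HF[of 0 d] h0[of d] by simp
  qed (simp add: H_def)
  have rY: "r x \<in> Y" if x: "x \<in> topspace Z" for x
  proof (cases "x \<in> Y")
    case False
    then obtain d where d: "d \<in> topspace D - {c}" "x = \<phi> d" using ex x by blast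
    have "\<phi> (h (1, d)) \<in> Y" using h_in[of 1 d] h1[of d] d bd by auto
    then show ?thesis using HF[of 1 d] d by (simp add: r_def)
  qed (simp add: H_def r_def)
  have "homotopic_with (\<lambda>_. True) Z Z id r"
    by (subst homotopic_with) (use cont_H H0 in \<open>auto simp: r_def\<close>)
  then have hom: "homotopic_with (\<lambda>_. True) Z Z r id" by (simp add: homotopic_with_sym)
  have "continuous_map Z Z (H \<circ> Pair 1)"
    by (rule continuous_map_o_Pair[OF cont_H]) simp
  then have cr: "continuous_map Z Z r" by (simp add: o_def r_def[abs_def])
  have YZ': "subtopology X Y = subtopology Z Y"
    using YZ by (simp add: Z_def subtopology_subtopology) (metis inf.absorb2 tZ)
  have "retraction_maps Z (subtopology X Y) r id"
    unfolding retraction_maps_def YZ'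
    using cr rY YZ by (auto simp: continuous_map_in_subtopology r_def H_def)
  from deformation_retract_imp_isomorphic_homology_groups[OF this hom]
  show ?thesis by (simp add: Z_def)
qed

text \<open>Excising \<open>Y\<close> leaves the open cell, which \<open>\<phi>\<close> identifies with \<open>U\<close>: a continuous bijection obtained by
  restricting a closed map to a full preimage is a homeomorphism.\<close>

lemma local_homology_attach_cell:
  fixes D :: "'d topology" and X :: "'a topology"
  assumes X: "Hausdorff_space X" and D: "compact_space D" and phi: "continuous_map D X \<phi>"
    and Y: "closedin X Y" and U: "U \<subseteq> topspace D" and bij: "bij_betw \<phi> U (topspace X - Y)"
    and bd: "\<phi> ` (topspace D - U) \<subseteq> Y" and c: "c \<in> U"
  shows "relative_homology_group p X (topspace X - {\<phi> c})
    \<cong> relative_homology_group p (subtopology D U) (U - {c})"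
proof -
  have inj: "inj_on \<phi> U" and im: "\<phi> ` U = topspace X - Y" using bij by (auto simp: bij_betw_def)
  have cl: "closed_map D X \<phi>"
    using D X phi by (simp add: continuous_imp_proper_map Hausdorff_imp_kc_space proper_imp_closed_map)
  have "{d \<in> topspace D. \<phi> d \<in> topspace X - Y} = U" using im bd U by auto
  from closed_map_restriction[OF cl this]
  have "homeomorphic_map (subtopology D U) (subtopology X (topspace X - Y)) \<phi>"
    using phi inj im U
    by (intro bijective_closed_imp_homeomorphic_map)
       (auto simp: continuous_map_in_subtopology continuous_map_from_subtopology inf_absorb2 Int_absorb1)
  moreover have "\<phi> ` (U - {c}) = topspace X - Y - {\<phi> c}"
    using inj im c by (auto simp: inj_on_def)
  ultimately have "relative_homology_group p (subtopology D U) (U - {c})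
      \<cong> relative_homology_group p (subtopology X (topspace X - Y)) (topspace X - Y - {\<phi> c})"
    using U by (intro is_isoI[OF homeomorphic_map_relative_homology_iso]) auto
  from group.iso_sym[OF group_relative_homology_group this]
  have 1: "relative_homology_group p (subtopology X (topspace X - Y)) (topspace X - Y - {\<phi> c})
     \<cong> relative_homology_group p (subtopology D U) (U - {c})" .
  have "relative_homology_group p X (topspace X - {\<phi> c})
      \<cong> relative_homology_group p (subtopology X (topspace X - Y)) (topspace X - Y - {\<phi> c})"
    using X Y im c by (intro excision_at_point) (auto simp: Hausdorff_imp_t1_space)
  from iso_trans[OF this 1] show ?thesis .
qed

text \<open>The exact sequence of the pair \<open>(X, X - {\<phi> c})\<close>: its subspace has the homology of \<open>Y\<close>, and its
  relative groups are the local homology of the model at the centre.\<close>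

lemma has_euler_attach_cell:
  fixes D :: "'d topology" and X :: "'a topology"
  assumes X: "Hausdorff_space X" and D: "compact_space D" and phi: "continuous_map D X \<phi>"
    and Y: "closedin X Y" and U: "U \<subseteq> topspace D" and bij: "bij_betw \<phi> U (topspace X - Y)"
    and bd: "\<phi> ` (topspace D - U) \<subseteq> Y" and c: "c \<in> U"
    and h: "continuous_map (prod_topology (top_of_set {0..1::real}) (subtopology D (topspace D - {c})))
      (subtopology D (topspace D - {c})) h"
    and h0: "\<And>x. x \<in> topspace D - {c} \<Longrightarrow> h (0, x) = x"
    and h1: "\<And>x. x \<in> topspace D - {c} \<Longrightarrow> h (1, x) \<notin> U"
    and hbd: "\<And>t x. \<lbrakk>t \<in> {0..1}; x \<in> topspace D - U\<rbrakk> \<Longrightarrow> h (t, x) = x"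
    and eY: "has_euler (subtopology X Y) {} d"
    and eD: "has_euler (subtopology D U) (U - {c}) e"
  shows "has_euler X {} (d + e)"
proof (rule has_euler_exact)
  show "has_euler (subtopology X (topspace X - {\<phi> c})) {} d"
    by (rule has_euler_iso[OF eY homology_attach_cell_punctured[OF X D phi Y U bij bd c h h0 h1 hbd]])
  show "has_euler X (topspace X - {\<phi> c}) e"
    by (rule has_euler_iso[OF eD local_homology_attach_cell[OF X D phi Y U bij bd c]])
qed

section \<open>Products of disks\<close>

text \<open>A product of disks serves directly as the model of a cell, because a product of characteristic maps
  is then a characteristic map. The gauge below is the maximum of the Euclidean norms of
  the factors; its unit ball is the product of the disks and its unit sphere the boundary.\<close>

definition polydisk :: "'i set \<Rightarrow> ('i \<Rightarrow> nat) \<Rightarrow> ('i \<Rightarrow> nat \<Rightarrow> real) topology" where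
  "polydisk I n = product_topology (\<lambda>i. disk (n i)) I"

definition polydisk_interior :: "'i set \<Rightarrow> ('i \<Rightarrow> nat) \<Rightarrow> ('i \<Rightarrow> nat \<Rightarrow> real) set" where
  "polydisk_interior I n = (\<Pi>\<^sub>E i\<in>I. disk_interior (n i))"

definition polydisk_centre :: "'i set \<Rightarrow> 'i \<Rightarrow> nat \<Rightarrow> real" where
  "polydisk_centre I = (\<lambda>i\<in>I. \<lambda>_. 0)"

definition scale :: "'i set \<Rightarrow> real \<Rightarrow> ('i \<Rightarrow> nat \<Rightarrow> real) \<Rightarrow> 'i \<Rightarrow> nat \<Rightarrow> real" where
  "scale I s x = (\<lambda>i\<in>I. \<lambda>j. s * x i j)"

definition disk_norm :: "nat \<Rightarrow> (nat \<Rightarrow> real) \<Rightarrow> real" where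
  "disk_norm k x = sqrt (\<Sum>j<k. x j ^ 2)"

text \<open>The inserted \<open>0\<close> covers the empty product, a single point of dimension 0.\<close>

definition gauge_norm :: "'i set \<Rightarrow> ('i \<Rightarrow> nat) \<Rightarrow> ('i \<Rightarrow> nat \<Rightarrow> real) \<Rightarrow> real" where
  "gauge_norm I n x = Max (insert 0 ((\<lambda>i. disk_norm (n i) (x i)) ` I))"

lemma topspace_disk: "topspace (disk k) = {x. (\<forall>j\<ge>k. x j = 0) \<and> disk_norm k x \<le> 1}"
  by (auto simp: disk_def topspace_Euclidean_space disk_norm_def)

lemma disk_interior_eq: "disk_interior k = {x. (\<forall>j\<ge>k. x j = 0) \<and> disk_norm k x < 1}"
  by (auto simp: disk_interior_def topspace_Euclidean_space disk_norm_def)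

lemma disk_norm_nonneg [simp]: "0 \<le> disk_norm k x"
  by (simp add: disk_norm_def sum_nonneg)

lemma disk_norm_scale: "s \<ge> 0 \<Longrightarrow> disk_norm k (\<lambda>j. s * x j) = s * disk_norm k x"
  by (simp add: disk_norm_def power_mult_distrib real_sqrt_mult flip: sum_distrib_left)

lemma disk_norm_eq_0: "disk_norm k x = 0 \<longleftrightarrow> (\<forall>j<k. x j = 0)"
  by (auto simp: disk_norm_def sum_nonneg_eq_0_iff)

lemma gauge_norm_nonneg [simp]: "finite I \<Longrightarrow> 0 \<le> gauge_norm I n x"
  by (simp add: gauge_norm_def)

lemma gauge_norm_le_iff:
  "\<lbrakk>finite I; 0 \<le> b\<rbrakk> \<Longrightarrow> gauge_norm I n x \<le> b \<longleftrightarrow> (\<forall>i\<in>I. disk_norm (n i) (x i) \<le> b)"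
  by (simp add: gauge_norm_def)

lemma gauge_norm_less_iff:
  "\<lbrakk>finite I; 0 < b\<rbrakk> \<Longrightarrow> gauge_norm I n x < b \<longleftrightarrow> (\<forall>i\<in>I. disk_norm (n i) (x i) < b)"
  by (simp add: gauge_norm_def)

lemma gauge_norm_scale:
  assumes "finite I" "s \<ge> 0"
  shows "gauge_norm I n (scale I s x) = s * gauge_norm I n x"
proof -
  have "(\<lambda>i. disk_norm (n i) (scale I s x i)) ` I = (*) s ` (\<lambda>i. disk_norm (n i) (x i)) ` I"
    unfolding image_image using assms(2) by (intro image_cong) (auto simp: scale_def disk_norm_scale)
  then have "gauge_norm I n (scale I s x) = Max ((*) s ` insert 0 ((\<lambda>i. disk_norm (n i) (x i)) ` I))"
    by (simp add: gauge_norm_def)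
  also have "\<dots> = s * gauge_norm I n x"
    unfolding gauge_norm_def using assms
    by (intro mono_Max_commute[symmetric]) (auto simp: mono_def mult_left_mono)
  finally show ?thesis .
qed

lemma topspace_polydisk:
  "finite I \<Longrightarrow> topspace (polydisk I n) =
     {x \<in> extensional I. (\<forall>i\<in>I. \<forall>j\<ge>n i. x i j = 0) \<and> gauge_norm I n x \<le> 1}"
  by (auto simp: polydisk_def topspace_disk gauge_norm_le_iff PiE_def)

lemma polydisk_interior_eq:
  "finite I \<Longrightarrow> polydisk_interior I n =
     {x \<in> extensional I. (\<forall>i\<in>I. \<forall>j\<ge>n i. x i j = 0) \<and> gauge_norm I n x < 1}"
  by (auto simp: polydisk_interior_def disk_interior_eq gauge_norm_less_iff PiE_def)

lemma polydisk_interior_subset: "finite I \<Longrightarrow> polydisk_interior I n \<subseteq> topspace (polydisk I n)"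
  by (auto simp: topspace_polydisk polydisk_interior_eq)

lemma gauge_norm_eq_0:
  assumes "finite I" "x \<in> extensional I" "\<And>i j. \<lbrakk>i \<in> I; j \<ge> n i\<rbrakk> \<Longrightarrow> x i j = 0"
  shows "gauge_norm I n x = 0 \<longleftrightarrow> x = polydisk_centre I"
proof
  assume 0: "gauge_norm I n x = 0"
  have "x i j = 0" if "i \<in> I" for i j
  proof -
    have "disk_norm (n i) (x i) \<le> 0" using gauge_norm_le_iff[OF assms(1), of 0 n x] 0 that by simp
    then have "disk_norm (n i) (x i) = 0" using disk_norm_nonneg[of "n i" "x i"] by linarith
    then show ?thesis using assms(3)[OF that, of j] by (auto simp: disk_norm_eq_0 not_le[symmetric])
  qed
  then show "x = polydisk_centre I" using assms(2)
    by (auto simp: polydisk_centre_def fun_eq_iff extensional_def restrict_def)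
next
  assume "x = polydisk_centre I"
  then have "\<forall>i\<in>I. disk_norm (n i) (x i) \<le> 0" by (simp add: polydisk_centre_def disk_norm_def)
  then show "gauge_norm I n x = 0"
    using assms(1) gauge_norm_le_iff[OF assms(1), of 0 n x] gauge_norm_nonneg[OF assms(1), of n x]
    by simp
qed

lemma centre_in_polydisk_interior:
  assumes "finite I"
  shows "polydisk_centre I \<in> polydisk_interior I n"
  by (auto simp: polydisk_centre_def polydisk_interior_def disk_interior_eq disk_norm_def)

lemma scale_1: "x \<in> extensional I \<Longrightarrow> scale I 1 x = x"
  by (auto simp: scale_def extensional_def restrict_def fun_eq_iff)

lemma continuous_map_Euclidean_coordinate: "continuous_map (Euclidean_space k) euclideanreal (\<lambda>x. x j)"
  unfolding Euclidean_space_def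
  by (intro continuous_map_from_subtopology continuous_map_product_projection) simp

lemma continuous_map_disk_coordinate: "continuous_map (disk k) euclideanreal (\<lambda>x. x j)"
  unfolding disk_def by (intro continuous_map_from_subtopology continuous_map_Euclidean_coordinate)

lemma continuous_map_polydisk_coordinate:
  assumes "i \<in> I"
  shows "continuous_map (polydisk I n) euclideanreal (\<lambda>x. x i j)"
  using continuous_map_compose[OF continuous_map_product_projection[OF assms]
      continuous_map_disk_coordinate, of "\<lambda>i. n i" j]
  by (simp add: polydisk_def o_def)

lemma continuous_map_Max_insert:
  assumes "finite J" "\<And>i. i \<in> J \<Longrightarrow> continuous_map X euclideanreal (\<lambda>x. f x i)"
  shows "continuous_map X euclideanreal (\<lambda>x. Max (insert 0 (f x ` J)))"
  using assms
proof (induction J)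
  case (insert i J)
  have "Max (insert 0 (f x ` insert i J)) = max (f x i) (Max (insert 0 (f x ` J)))" for x
    using insert.hyps by (simp add: insert_commute[of 0 "f x i"])
  then show ?case using insert by (simp add: continuous_map_real_max)
qed simp

lemma continuous_map_gauge_norm:
  assumes "finite I"
  shows "continuous_map (polydisk I n) euclideanreal (gauge_norm I n)"
proof -
  have "continuous_map (polydisk I n) euclideanreal (\<lambda>x. disk_norm (n i) (x i))" if "i \<in> I" for i
    unfolding disk_norm_def
    by (intro continuous_intros continuous_map_polydisk_coordinate that finite_lessThan)
  from continuous_map_Max_insert[OF assms this]
  show ?thesis by (simp add: gauge_norm_def[abs_def])
qed

text \<open>Both the product and the Euclidean topologies are initial, so it suffices to test real coordinates.\<close>

lemma continuous_map_into_polydisk: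
  assumes "\<And>i j. i \<in> I \<Longrightarrow> continuous_map X euclideanreal (\<lambda>z. f z i j)"
    and "f \<in> topspace X \<rightarrow> topspace (polydisk I n)"
  shows "continuous_map X (polydisk I n) f"
  unfolding polydisk_def continuous_map_componentwise
proof (intro conjI ballI)
  show "f ` topspace X \<subseteq> extensional I"
    using assms(2) by (auto simp: polydisk_def PiE_def)
next
  fix i assume i: "i \<in> I"
  have "f z i \<in> topspace (disk (n i))" if "z \<in> topspace X" for z
    using assms(2) that i by (auto simp: polydisk_def)
  then show "continuous_map X (disk (n i)) (\<lambda>z. f z i)"
    unfolding disk_def Euclidean_space_def continuous_map_in_subtopology
    using assms(1)[OF i] by (auto simp: continuous_map_componentwise_UNIV)
qed

text \<open>The punctured polydisk retracts along rays onto the unit sphere of the gauge: at time \<open>t\<close> the point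
  \<open>x\<close> is multiplied by \<open>(1 - t) + t / gauge x\<close>, so that its gauge moves linearly to \<open>1\<close>.\<close>

lemma polydisk_radial_deformation:
  fixes I :: "'i set" and n :: "'i \<Rightarrow> nat"
  assumes I: "finite I"
  defines "D' \<equiv> subtopology (polydisk I n) (topspace (polydisk I n) - {polydisk_centre I})"
  obtains h where
    "continuous_map (prod_topology (top_of_set {0..1::real}) D') D' h"
    "\<And>x. x \<in> topspace (polydisk I n) - {polydisk_centre I} \<Longrightarrow> h (0, x) = x"
    "\<And>x. x \<in> topspace (polydisk I n) - {polydisk_centre I} \<Longrightarrow> h (1, x) \<notin> polydisk_interior I n"
    "\<And>t x. \<lbrakk>t \<in> {0..1}; x \<in> topspace (polydisk I n) - polydisk_interior I n\<rbrakk> \<Longrightarrow> h (t, x) = x"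
proof
  let ?g = "gauge_norm I n"
  define s where "s = (\<lambda>(t, x). (1 - t) + t / ?g x)"
  define h where "h = (\<lambda>z. scale I (s z) (snd z))"
  let ?P = "prod_topology (top_of_set {0..1::real}) D'"
  have tD: "topspace D' = topspace (polydisk I n) - {polydisk_centre I}"
    by (auto simp: D'_def)
  have g_pos: "?g x > 0" and g_le: "?g x \<le> 1" if "x \<in> topspace D'" for x
    using that I gauge_norm_eq_0[OF I, of x n] gauge_norm_nonneg[OF I, of n x]
    by (auto simp: tD topspace_polydisk less_le)
  have s_nonneg: "s (t, x) \<ge> 0" if "t \<in> {0..1}" "x \<in> topspace D'" for t x
    using that g_pos[of x] by (auto simp: s_def)
  have g_h: "?g (h (t, x)) = (1 - t) * ?g x + t" if "t \<in> {0..1}" "x \<in> topspace D'" for t x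
    using gauge_norm_scale[OF I s_nonneg[OF that], of n x] g_pos[OF that(2)]
    by (simp add: h_def s_def algebra_simps)
  have h_in: "h (t, x) \<in> topspace D'" if t: "t \<in> {0..1}" and x: "x \<in> topspace D'" for t x
  proof -
    have "(1 - t) * ?g x + t \<le> (1 - t) * 1 + t"
      using t g_le[OF x] by (intro add_right_mono mult_left_mono) auto
    moreover have "(1 - t) * ?g x + t > 0"
      using t g_pos[OF x] by (cases "t = 0") (auto intro: add_nonneg_pos)
    ultimately have g: "0 < ?g (h (t, x))" "?g (h (t, x)) \<le> 1" using g_h[OF t x] by auto
    have ext: "h (t, x) \<in> extensional I" by (simp add: h_def scale_def)
    have zero: "h (t, x) i j = 0" if "i \<in> I" "j \<ge> n i" for i j
      using x that I by (auto simp: h_def scale_def tD topspace_polydisk)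
    show ?thesis
      using g ext zero gauge_norm_eq_0[OF I ext zero] I by (auto simp: tD topspace_polydisk)
  qed
  have cont_fst: "continuous_map ?P euclideanreal fst"
    using continuous_map_fst[of "top_of_set {0..1::real}" D'] continuous_map_into_fulltopology by blast
  have cont_snd: "continuous_map ?P (polydisk I n) snd"
    using continuous_map_snd[of "top_of_set {0..1::real}" D'] unfolding D'_def
    by (rule continuous_map_into_fulltopology)
  have cont_g: "continuous_map ?P euclideanreal (\<lambda>z. ?g (snd z))"
    using continuous_map_compose[OF cont_snd continuous_map_gauge_norm[OF I]] by (simp add: o_def)
  have g_nz: "?g (snd z) \<noteq> 0" if "z \<in> topspace ?P" for z
    using that g_pos[of "snd z"] by (auto simp: mem_Times_iff)
  have cont_s: "continuous_map ?P euclideanreal s"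
    unfolding s_def case_prod_unfold
    by (intro continuous_map_add continuous_map_diff continuous_map_real_divide cont_fst cont_g g_nz)
      simp_all
  have cont: "continuous_map ?P euclideanreal (\<lambda>z. h z i j)" if "i \<in> I" for i j
  proof -
    have "continuous_map ?P euclideanreal (\<lambda>z. s z * snd z i j)"
      using continuous_map_compose[OF cont_snd continuous_map_polydisk_coordinate[OF that, of n j]]
      by (intro continuous_map_real_mult cont_s) (simp add: o_def)
    then show ?thesis using that by (simp add: h_def scale_def)
  qed
  have into: "h \<in> topspace ?P \<rightarrow> topspace D'" using h_in by auto
  then have "h \<in> topspace ?P \<rightarrow> topspace (polydisk I n)" by (auto simp: tD)
  from continuous_map_into_polydisk[OF cont this] have "continuous_map ?P (polydisk I n) h" .
  then show "continuous_map ?P D' h"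
    using into unfolding D'_def by (auto simp: continuous_map_in_subtopology)
  have ext: "x \<in> extensional I" if "x \<in> topspace (polydisk I n)" for x
    using that I by (auto simp: topspace_polydisk)
  show "h (0, x) = x" if "x \<in> topspace (polydisk I n) - {polydisk_centre I}" for x
    using that ext by (simp add: h_def s_def scale_1)
  show "h (1, x) \<notin> polydisk_interior I n" if "x \<in> topspace (polydisk I n) - {polydisk_centre I}" for x
    using g_h[of 1 x] that I by (simp add: tD polydisk_interior_eq)
  show "h (t, x) = x" if "t \<in> {0..1}" "x \<in> topspace (polydisk I n) - polydisk_interior I n" for t x
  proof -
    have "?g x = 1" using that I by (auto simp: topspace_polydisk polydisk_interior_eq)
    then show ?thesis using that ext by (simp add: h_def s_def scale_1)
  qed
qed

lemma compact_space_disk: "compact_space (disk k)"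
proof -
  let ?K = "\<Pi>\<^sub>E j\<in>UNIV. {-1..1::real}"
  have eq: "disk k = subtopology (powertop_real UNIV) (topspace (disk k))"
    by (simp add: disk_def Euclidean_space_def subtopology_subtopology Int_ac)
  have "compactin (powertop_real UNIV) ?K"
    by (simp add: compactin_PiE compactin_euclidean_iff)
  moreover have "closedin (powertop_real UNIV) (topspace (disk k))"
  proof -
    have c: "continuous_map (Euclidean_space k) euclideanreal (disk_norm k)"
      unfolding disk_norm_def[abs_def]
      by (intro continuous_intros continuous_map_Euclidean_coordinate finite_lessThan)
    have "closedin (Euclidean_space k) {x \<in> topspace (Euclidean_space k). disk_norm k x \<in> {..1}}"
      by (rule closedin_continuous_map_preimage[OF c]) simp
    also have "{x \<in> topspace (Euclidean_space k). disk_norm k x \<in> {..1}} = topspace (disk k)"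
      by (auto simp: topspace_disk topspace_Euclidean_space)
    finally have "closedin (Euclidean_space k) (topspace (disk k))" .
    then have "closedin (subtopology (powertop_real UNIV) (topspace (Euclidean_space k)))
        (topspace (disk k))"
      by (simp add: Euclidean_space_def)
    then show ?thesis using closedin_Euclidean_space by (rule closedin_trans_full)
  qed
  moreover have "topspace (disk k) \<subseteq> ?K"
  proof
    fix x assume x: "x \<in> topspace (disk k)"
    have "\<bar>x j\<bar> \<le> 1" for j
    proof (cases "j < k")
      case True
      then have "x j ^ 2 \<le> (\<Sum>j<k. x j ^ 2)" by (intro member_le_sum) auto
      also have "\<dots> \<le> 1" using x by (auto simp: disk_def)
      finally show ?thesis by (simp add: abs_square_le_1)
    next
      case False
      then show ?thesis using x by (auto simp: topspace_disk)
    qed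
    then show "x \<in> ?K" by (auto simp: abs_le_iff minus_le_iff PiE_UNIV_domain)
  qed
  ultimately have "compactin (powertop_real UNIV) (topspace (disk k))"
    by (metis closed_compactin)
  then show ?thesis by (subst eq) (simp add: compact_space_subtopology)
qed

lemma compact_space_polydisk: "compact_space (polydisk I n)"
  by (simp add: polydisk_def compact_space_product_topology compact_space_disk)

text \<open>The coordinates of the factors are concatenated, in any order: \<open>b\<close> enumerates the pairs of a factor
  and one of its coordinates.\<close>

lemma homeomorphic_map_product_Euclidean:
  assumes I: "finite I"
  obtains F where
    "homeomorphic_map (product_topology (\<lambda>i. Euclidean_space (n i)) I) (Euclidean_space (sum n I)) F"
    "F (polydisk_centre I) = (\<lambda>_. 0)"
proof -
  let ?P = "product_topology (\<lambda>i. Euclidean_space (n i)) I"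
  let ?N = "sum n I"
  let ?S = "SIGMA i:I. {..<n i}"
  have "finite ?S" "card ?S = ?N" using I by (auto simp: card_SigmaI)
  then obtain b where b: "bij_betw b {..<?N} ?S"
    using ex_bij_betw_nat_finite[of ?S] by (auto simp: atLeast0LessThan)
  define F where "F x = (\<lambda>k. if k < ?N then x (fst (b k)) (snd (b k)) else 0 :: real)"
    for x :: "'a \<Rightarrow> nat \<Rightarrow> real"
  define G where "G y = (\<lambda>i\<in>I. \<lambda>j. if j < n i then y (inv_into {..<?N} b (i, j)) else 0 :: real)"
    for y :: "nat \<Rightarrow> real"
  have bS: "fst (b k) \<in> I" "snd (b k) < n (fst (b k))" if "k < ?N" for k
    using bij_betwE[OF b] that by (force simp: mem_Times_iff)+
  have inv: "inv_into {..<?N} b (i, j) < ?N" "b (inv_into {..<?N} b (i, j)) = (i, j)"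
    if "i \<in> I" "j < n i" for i j
  proof -
    have "(i, j) \<in> b ` {..<?N}" using b that by (auto simp: bij_betw_def)
    then show "inv_into {..<?N} b (i, j) < ?N" "b (inv_into {..<?N} b (i, j)) = (i, j)"
      using inv_into_into[of "(i, j)" b "{..<?N}"] f_inv_into_f[of "(i, j)" b "{..<?N}"] by auto
  qed
  have cF: "continuous_map ?P (Euclidean_space ?N) F"
    unfolding F_def continuous_map_componentwise_Euclidean_space
    using continuous_map_compose[OF continuous_map_product_projection[OF bS(1)]
      continuous_map_Euclidean_coordinate]
    by (auto simp: o_def)
  have cG: "continuous_map (Euclidean_space ?N) ?P G"
    unfolding continuous_map_componentwise
  proof (intro conjI ballI)
    fix i assume i: "i \<in> I"
    have "continuous_map (Euclidean_space ?N) (Euclidean_space (n i))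
      (\<lambda>y j. if j < n i then y (inv_into {..<?N} b (i, j)) else 0)"
      unfolding continuous_map_componentwise_Euclidean_space
      by (simp add: continuous_map_Euclidean_coordinate)
    then show "continuous_map (Euclidean_space ?N) (Euclidean_space (n i)) (\<lambda>y. G y i)"
      using i by (simp add: G_def)
  qed (auto simp: G_def)
  have GF: "G (F x) = x" if "x \<in> topspace ?P" for x
  proof (rule extensionalityI[of _ I])
    show "x \<in> extensional I" using that by (auto simp: PiE_def)
    show "G (F x) i = x i" if i: "i \<in> I" for i
    proof
      fix j
      have "x i j = 0" if "j \<ge> n i"
        using \<open>x \<in> topspace ?P\<close> i that by (auto simp: topspace_Euclidean_space)
      then show "G (F x) i j = x i j" using i inv[OF i, of j] by (auto simp: G_def F_def)
    qed
  qed (simp add: G_def)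
  have FG: "F (G y) = y" if "y \<in> topspace (Euclidean_space ?N)" for y
  proof
    fix k
    have "inv_into {..<?N} b (b k) = k" if "k < ?N"
      using b that by (intro inv_into_f_f) (auto simp: bij_betw_def)
    then show "F (G y) k = y k"
      using that bS[of k] by (auto simp: F_def G_def topspace_Euclidean_space)
  qed
  have "homeomorphic_maps ?P (Euclidean_space ?N) F G"
    using cF cG GF FG by (simp add: homeomorphic_maps_def)
  then have "homeomorphic_map ?P (Euclidean_space ?N) F" by (auto simp: homeomorphic_map_maps)
  moreover have "F (polydisk_centre I) = (\<lambda>_. 0)"
    using bS by (auto simp: F_def polydisk_centre_def)
  ultimately show thesis by (rule that)
qed

text \<open>The open polydisk is an open neighbourhood of the centre in a product of Euclidean spaces, so by
  excision it has the local homology of a Euclidean space of the total dimension.\<close>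

lemma has_euler_polydisk_interior:
  fixes n :: "'i \<Rightarrow> nat"
  assumes I: "finite I"
  shows "has_euler (subtopology (polydisk I n) (polydisk_interior I n))
           (polydisk_interior I n - {polydisk_centre I}) ((-1) ^ sum n I)"
proof -
  let ?P = "product_topology (\<lambda>i. Euclidean_space (n i)) I"
  let ?U = "polydisk_interior I n"
  let ?c = "polydisk_centre I :: 'i \<Rightarrow> nat \<Rightarrow> real"
  have "polydisk I n = subtopology ?P (\<Pi>\<^sub>E i\<in>I. {x. (\<Sum>j<n i. x j ^ 2) \<le> 1})"
    by (simp add: polydisk_def disk_def[abs_def] subtopology_product_topology)
  moreover have "?U \<subseteq> (\<Pi>\<^sub>E i\<in>I. {x. (\<Sum>j<n i. x j ^ 2) \<le> 1})"
    unfolding polydisk_interior_def by (intro PiE_mono) (auto simp: disk_interior_def)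
  ultimately have sub: "subtopology (polydisk I n) ?U = subtopology ?P ?U"
    by (simp add: subtopology_subtopology inf_absorb2)
  have UP: "?U \<subseteq> topspace ?P"
    unfolding polydisk_interior_def topspace_product_topology
    by (intro PiE_mono) (auto simp: disk_interior_def)
  have "openin (Euclidean_space k) (disk_interior k)" for k
  proof -
    have c: "continuous_map (Euclidean_space k) euclideanreal (disk_norm k)"
      unfolding disk_norm_def[abs_def]
      by (intro continuous_intros continuous_map_Euclidean_coordinate finite_lessThan)
    have "openin (Euclidean_space k) {x \<in> topspace (Euclidean_space k). disk_norm k x \<in> {..<1}}"
      by (rule openin_continuous_map_preimage[OF c]) simp
    also have "{x \<in> topspace (Euclidean_space k). disk_norm k x \<in> {..<1}} = disk_interior k"
      by (auto simp: disk_interior_eq topspace_Euclidean_space)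
    finally show ?thesis .
  qed
  then have "openin ?P ?U"
    unfolding polydisk_interior_def using I by (simp add: openin_PiE)
  then have cl: "closedin ?P (topspace ?P - ?U)" by blast
  have c: "?c \<in> ?U" by (rule centre_in_polydisk_interior[OF I])
  have t1: "t1_space ?P"
    by (intro Hausdorff_imp_t1_space) (simp add: Hausdorff_space_product_topology Hausdorff_Euclidean_space)
  have "?c \<in> topspace ?P - (topspace ?P - ?U)" using c UP by auto
  from excision_at_point[OF t1 cl this]
  have "relative_homology_group p ?P (topspace ?P - {?c})
      \<cong> relative_homology_group p (subtopology (polydisk I n) ?U) (?U - {?c})" for p
    by (simp only: sub double_diff[OF UP subset_refl])
  from group.iso_sym[OF group_relative_homology_group this]
  have 1: "relative_homology_group p (subtopology (polydisk I n) ?U) (?U - {?c})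
      \<cong> relative_homology_group p ?P (topspace ?P - {?c})" for p .
  obtain F where F: "homeomorphic_map ?P (Euclidean_space (sum n I)) F" "F ?c = (\<lambda>_. 0)"
    using homeomorphic_map_product_Euclidean[OF I] by blast
  have "F ` (topspace ?P - {?c}) = topspace (Euclidean_space (sum n I)) - {\<lambda>_. 0}"
  proof -
    have "inj_on F (topspace ?P)" "F ` topspace ?P = topspace (Euclidean_space (sum n I))"
      using F(1) by (auto simp: homeomorphic_eq_everything_map)
    moreover have "?c \<in> topspace ?P" using c UP by auto
    ultimately show ?thesis using F(2)
      by (subst inj_on_image_set_diff[of F "topspace ?P"]) auto
  qed
  from is_isoI[OF homeomorphic_map_relative_homology_iso[OF F(1) Diff_subset this]]
  have "relative_homology_group p ?P (topspace ?P - {?c})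
      \<cong> relative_homology_group p (Euclidean_space (sum n I))
          (topspace (Euclidean_space (sum n I)) - {\<lambda>_. 0})" for p .
  from has_euler_iso[OF has_euler_Euclidean_punctured iso_trans[OF 1 this]]
  show ?thesis .
qed

lemma has_euler_attach_polydisk:
  fixes I :: "'i set" and X :: "'a topology"
  assumes X: "Hausdorff_space X" and Y: "closedin X Y" and I: "finite I"
    and phi: "continuous_map (polydisk I n) X \<phi>"
    and bij: "bij_betw \<phi> (polydisk_interior I n) (topspace X - Y)"
    and bd: "\<phi> ` (topspace (polydisk I n) - polydisk_interior I n) \<subseteq> Y"
    and eY: "has_euler (subtopology X Y) {} d"
  shows "has_euler X {} (d + (-1) ^ sum n I)"
proof -
  obtain h where h: "continuous_map (prod_topology (top_of_set {0..1::real})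
        (subtopology (polydisk I n) (topspace (polydisk I n) - {polydisk_centre I})))
        (subtopology (polydisk I n) (topspace (polydisk I n) - {polydisk_centre I})) h"
    "\<And>x. x \<in> topspace (polydisk I n) - {polydisk_centre I} \<Longrightarrow> h (0, x) = x"
    "\<And>x. x \<in> topspace (polydisk I n) - {polydisk_centre I} \<Longrightarrow> h (1, x) \<notin> polydisk_interior I n"
    "\<And>t x. \<lbrakk>t \<in> {0..1}; x \<in> topspace (polydisk I n) - polydisk_interior I n\<rbrakk> \<Longrightarrow> h (t, x) = x"
    using polydisk_radial_deformation[OF I, of n] by metis
  show ?thesis
    by (rule has_euler_attach_cell[OF X compact_space_polydisk phi Y polydisk_interior_subset[OF I]
          bij bd centre_in_polydisk_interior[OF I] h eY has_euler_polydisk_interior[OF I]])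
qed

section \<open>Counting cells\<close>

text \<open>The index type of the factors is fixed to \<open>nat\<close>, since a type cannot be quantified in the formula.
  The set \<open>L\<close> will be the union of the cells of lower dimension.\<close>

definition polydisk_attached :: "'a topology \<Rightarrow> nat \<Rightarrow> 'a set \<Rightarrow> 'a set \<Rightarrow> bool" where
  "polydisk_attached X d e L \<longleftrightarrow> (\<exists>(I :: nat set) n \<phi>. finite I \<and> sum n I = d \<and>
     continuous_map (polydisk I n) X \<phi> \<and> bij_betw \<phi> (polydisk_interior I n) e \<and>
     \<phi> ` (topspace (polydisk I n) - polydisk_interior I n) \<subseteq> L)"

text \<open>A finite CW structure whose cells are indexed by \<open>K\<close> and modelled on products of disks; the common
  generalisation of CW structures and of their products.\<close>

definition polydisk_complex ::
  "'a topology \<Rightarrow> 'k set \<Rightarrow> ('k \<Rightarrow> nat) \<Rightarrow> ('k \<Rightarrow> 'a set) \<Rightarrow> bool" where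
  "polydisk_complex X K d e \<longleftrightarrow>
     Hausdorff_space X \<and> finite K \<and> topspace X = (\<Union>k\<in>K. e k) \<and> disjoint_family_on e K \<and>
     (\<forall>k\<in>K. polydisk_attached X (d k) (e k) (\<Union>l\<in>{l \<in> K. d l < d k}. e l))"

lemma polydisk_attached_subtopology:
  assumes att: "polydisk_attached X d e L" and sub: "e \<subseteq> Y" "L \<subseteq> Y"
  shows "polydisk_attached (subtopology X Y) d e L"
proof -
  obtain I :: "nat set" and n \<phi> where phi: "finite I" "sum n I = d"
    "continuous_map (polydisk I n) X \<phi>" "bij_betw \<phi> (polydisk_interior I n) e"
    "\<phi> ` (topspace (polydisk I n) - polydisk_interior I n) \<subseteq> L"
    using att unfolding polydisk_attached_def by blast
  have "\<phi> x \<in> Y" if "x \<in> topspace (polydisk I n)" for x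
    using that phi(4,5) sub by (cases "x \<in> polydisk_interior I n") (auto simp: bij_betw_def)
  then have "continuous_map (polydisk I n) (subtopology X Y) \<phi>"
    using phi(3) by (auto simp: continuous_map_in_subtopology)
  with phi show ?thesis unfolding polydisk_attached_def by blast
qed

lemma polydisk_attached_closed:
  assumes att: "polydisk_attached X d e L" and X: "Hausdorff_space X"
  shows "\<exists>C. closedin X C \<and> e \<subseteq> C \<and> C \<subseteq> e \<union> L"
proof -
  obtain I :: "nat set" and n \<phi> where phi: "finite I"
    "continuous_map (polydisk I n) X \<phi>" "bij_betw \<phi> (polydisk_interior I n) e"
    "\<phi> ` (topspace (polydisk I n) - polydisk_interior I n) \<subseteq> L"
    using att unfolding polydisk_attached_def by blast
  let ?C = "\<phi> ` topspace (polydisk I n)"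
  have "compactin X ?C"
    using compact_space_polydisk[of I n] phi(2) by (simp add: compact_space_def image_compactin)
  then have "closedin X ?C" using X by (simp add: compactin_imp_closedin)
  moreover have "\<phi> ` polydisk_interior I n = e" using phi(3) by (simp add: bij_betw_def)
  then have "e \<subseteq> ?C" "?C \<subseteq> e \<union> L"
    using polydisk_interior_subset[OF phi(1), of n] phi(4) by auto
  ultimately show ?thesis by blast
qed

text \<open>No other cell has a cell of maximal dimension in its boundary, so the remaining cells contain the
  images of their closed models. These are compact, hence the union \<open>Y\<close> is closed.\<close>

lemma polydisk_complex_remove_top:
  assumes X: "polydisk_complex X K d e" and k0: "k0 \<in> K" "\<And>k. k \<in> K \<Longrightarrow> d k \<le> d k0"
    and Y: "Y = (\<Union>k\<in>K - {k0}. e k)"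
  shows "closedin X Y" "polydisk_complex (subtopology X Y) (K - {k0}) d e"
    "topspace X - Y = e k0"
proof -
  have H: "Hausdorff_space X" and fin: "finite K" and top: "topspace X = (\<Union>k\<in>K. e k)"
    and disj: "disjoint_family_on e K"
    and att: "\<And>k. k \<in> K \<Longrightarrow> polydisk_attached X (d k) (e k) (\<Union>l\<in>{l \<in> K. d l < d k}. e l)"
    using X by (auto simp: polydisk_complex_def)
  show "topspace X - Y = e k0"
  proof
    show "topspace X - Y \<subseteq> e k0" by (auto simp: top Y)
    show "e k0 \<subseteq> topspace X - Y"
      using k0(1) disj by (auto simp: top Y disjoint_family_on_def)
  qed
  have eq: "{l \<in> K. d l < d k} = {l \<in> K - {k0}. d l < d k}" if "k \<in> K" for k
    using k0(2)[OF that] by auto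
  have att': "polydisk_attached X (d k) (e k) (\<Union>l\<in>{l \<in> K - {k0}. d l < d k}. e l)"
    if "k \<in> K" for k
    using att[OF that] unfolding eq[OF that] .
  have LY: "(\<Union>l\<in>{l \<in> K - {k0}. d l < d k}. e l) \<subseteq> Y" for k by (auto simp: Y)
  have eY: "e k \<subseteq> Y" if "k \<in> K - {k0}" for k using that by (auto simp: Y)
  have "\<forall>k\<in>K - {k0}. \<exists>C. closedin X C \<and> e k \<subseteq> C \<and> C \<subseteq> Y"
  proof
    fix k assume k: "k \<in> K - {k0}"
    then obtain C where C: "closedin X C" "e k \<subseteq> C" "C \<subseteq> e k \<union> (\<Union>l\<in>{l \<in> K - {k0}. d l < d k}. e l)"
      using polydisk_attached_closed[OF att'[of k] H] by auto
    have "C \<subseteq> Y" using C(3) Un_least[OF eY[OF k] LY[of k]] by (rule order_trans)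
    with C(1,2) show "\<exists>C. closedin X C \<and> e k \<subseteq> C \<and> C \<subseteq> Y" by (intro exI[of _ C] conjI)
  qed
  from bchoice[OF this]
  obtain C where C: "\<forall>k\<in>K - {k0}. closedin X (C k) \<and> e k \<subseteq> C k \<and> C k \<subseteq> Y" ..
  have "Y = (\<Union>k\<in>K - {k0}. C k)"
  proof
    show "Y \<subseteq> (\<Union>k\<in>K - {k0}. C k)" unfolding Y by (rule UN_mono) (use C in auto)
    show "(\<Union>k\<in>K - {k0}. C k) \<subseteq> Y" using C by (intro UN_least) auto
  qed
  moreover have "closedin X (\<Union>k\<in>K - {k0}. C k)" using fin C by (intro closedin_Union) auto
  ultimately show cl: "closedin X Y" by simp
  show "polydisk_complex (subtopology X Y) (K - {k0}) d e"
    unfolding polydisk_complex_def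
  proof (intro conjI ballI)
    show "Hausdorff_space (subtopology X Y)" using H by (rule Hausdorff_space_subtopology)
    show "finite (K - {k0})" using fin by simp
    show "topspace (subtopology X Y) = (\<Union>k\<in>K - {k0}. e k)"
      using closedin_subset[OF cl] by (simp add: Y inf_absorb2)
    show "disjoint_family_on e (K - {k0})" using disj by (rule disjoint_family_on_mono[rotated]) auto
  next
    fix k assume k: "k \<in> K - {k0}"
    then show "polydisk_attached (subtopology X Y) (d k) (e k) (\<Union>l\<in>{l \<in> K - {k0}. d l < d k}. e l)"
      by (intro polydisk_attached_subtopology att' eY LY) auto
  qed
qed

text \<open>The cells are removed one by one in order of decreasing dimension; each contributes the Euler
  characteristic \<open>(-1) ^ dimension\<close> of its local homology.\<close>

lemma has_euler_polydisk_complex: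
  assumes "polydisk_complex X K d e"
  shows "has_euler X {} (\<Sum>k\<in>K. (-1) ^ d k)"
  using assms
proof (induction "card K" arbitrary: X K)
  case 0
  then have "K = {}" "topspace X = {}" by (auto simp: polydisk_complex_def)
  then show ?case using has_euler_empty[of X] by simp
next
  case (Suc N)
  have H: "Hausdorff_space X" and fin: "finite K"
    using Suc.prems by (simp_all add: polydisk_complex_def)
  have ne: "K \<noteq> {}" using Suc.hyps(2) by auto
  have "Max (d ` K) \<in> d ` K" using fin ne by simp
  then obtain k0 where k0: "k0 \<in> K" "d k0 = Max (d ` K)" by auto
  have max: "d k \<le> d k0" if "k \<in> K" for k using fin that k0(2) by simp
  define Y where "Y = (\<Union>k\<in>K - {k0}. e k)"
  have top1: "closedin X Y"
    by (rule polydisk_complex_remove_top(1)[OF Suc.prems k0(1) max Y_def])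
  have top2: "polydisk_complex (subtopology X Y) (K - {k0}) d e"
    by (rule polydisk_complex_remove_top(2)[OF Suc.prems k0(1) max Y_def])
  have top3: "topspace X - Y = e k0"
    by (rule polydisk_complex_remove_top(3)[OF Suc.prems k0(1) max Y_def])
  have "card (K - {k0}) = N" using Suc.hyps(2) k0(1) by simp
  from Suc.hyps(1)[OF this[symmetric] top2]
  have eY: "has_euler (subtopology X Y) {} (\<Sum>k\<in>K - {k0}. (-1) ^ d k)" .
  have "polydisk_attached X (d k0) (e k0) (\<Union>l\<in>{l \<in> K. d l < d k0}. e l)"
    using Suc.prems k0(1) by (simp add: polydisk_complex_def)
  then obtain I :: "nat set" and n \<phi> where cell: "finite I" "sum n I = d k0"
    "continuous_map (polydisk I n) X \<phi>" "bij_betw \<phi> (polydisk_interior I n) (e k0)"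
    "\<phi> ` (topspace (polydisk I n) - polydisk_interior I n) \<subseteq> (\<Union>l\<in>{l \<in> K. d l < d k0}. e l)"
    unfolding polydisk_attached_def by blast
  have "(\<Union>l\<in>{l \<in> K. d l < d k0}. e l) \<subseteq> Y" by (auto simp: Y_def)
  with cell(5) have bd: "\<phi> ` (topspace (polydisk I n) - polydisk_interior I n) \<subseteq> Y"
    by (rule order_trans)
  have bij: "bij_betw \<phi> (polydisk_interior I n) (topspace X - Y)"
    using cell(4) unfolding top3 .
  have "has_euler X {} ((\<Sum>k\<in>K - {k0}. (-1) ^ d k) + (-1) ^ sum n I)"
    by (rule has_euler_attach_polydisk[OF H top1 cell(1,3) bij bd eY])
  also have "(\<Sum>k\<in>K - {k0}. (-1) ^ d k) + (-1) ^ sum n I = (\<Sum>k\<in>K. (-1) ^ d k :: int)"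
    using fin k0(1) cell(2) by (simp add: sum.remove[of K k0])
  finally show ?case .
qed

section \<open>Cell structures of polyhedral products\<close>

definition characteristic_map ::
  "'a topology \<Rightarrow> (nat \<times> 'a set) set \<Rightarrow> nat \<times> 'a set \<Rightarrow> ((nat \<Rightarrow> real) \<Rightarrow> 'a) \<Rightarrow> bool" where
  "characteristic_map X E c \<phi> \<longleftrightarrow> continuous_map (disk (fst c)) X \<phi> \<and>
     bij_betw \<phi> (disk_interior (fst c)) (snd c) \<and>
     \<phi> ` disk_boundary (fst c) \<subseteq> (\<Union>d\<in>{d \<in> E. fst d < fst c}. snd d)"

text \<open>With projections in place of patterns on pairs, characteristic maps can be chosen cell by cell.\<close>

lemma finite_CW_structure_iff:
  "finite_CW_structure X E \<longleftrightarrow> Hausdorff_space X \<and> finite E \<and> topspace X = (\<Union>c\<in>E. snd c) \<and>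
     disjoint_family_on snd E \<and> (\<forall>c\<in>E. \<exists>\<phi>. characteristic_map X E c \<phi>)"
proof -
  have "(\<Union>(k, d)\<in>{(k, d) \<in> E. k < n}. d) = (\<Union>d\<in>{d \<in> E. fst d < n}. snd d)" for n
    by auto
  then show ?thesis
    by (simp add: finite_CW_structure_def characteristic_map_def disjoint_family_on_def
        pairwise_def disjnt_def case_prod_unfold)
qed

lemma disk_minus_interior: "topspace (disk k) - disk_interior k = disk_boundary k"
  by (auto simp: disk_def disk_interior_def disk_boundary_def)

text \<open>The closed disk is the closure of its interior. Along the segment from the centre to \<open>x\<close> all points
  but the last are interior, and the set of parameters that are mapped into \<open>B\<close> is closed.\<close>

lemma disk_map_into_closedin:
  assumes phi: "continuous_map (disk k) X \<phi>" and B: "closedin X B"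
    and int: "\<phi> ` disk_interior k \<subseteq> B" and x: "x \<in> topspace (disk k)"
  shows "\<phi> x \<in> B"
proof -
  let ?f = "\<lambda>(t :: real) j. t * x j"
  have norm: "disk_norm k (?f t) \<le> t" if "0 \<le> t" for t
    using that x by (simp add: disk_norm_scale topspace_disk mult_left_le)
  have f_in: "?f t \<in> topspace (disk k)" if "t \<in> {0..1}" for t
    using norm[of t] that x by (auto simp: topspace_disk)
  have f_int: "?f t \<in> disk_interior k" if "t \<in> {0..<1}" for t
    using norm[of t] that x by (auto simp: disk_interior_eq topspace_disk)
  have "continuous_map (top_of_set {0..1}) (disk k) ?f"
    unfolding disk_def Euclidean_space_def continuous_map_in_subtopology
  proof (intro conjI)
    show "continuous_map (top_of_set {0..1}) (powertop_real UNIV) ?f"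
      by (auto simp: continuous_map_componentwise_UNIV intro!: continuous_intros)
  qed (use f_in in \<open>auto simp: disk_def topspace_Euclidean_space\<close>)
  from continuous_map_compose[OF this phi]
  have "closedin (top_of_set {0..1}) {t \<in> topspace (top_of_set {0..1}). (\<phi> \<circ> ?f) t \<in> B}"
    using B by (rule closedin_continuous_map_preimage)
  then have "closed {t \<in> {0..1}. \<phi> (?f t) \<in> B}"
    by (simp add: closedin_closed_trans)
  moreover have "{0..<1} \<subseteq> {t \<in> {0..1}. \<phi> (?f t) \<in> B}"
    using f_int int by auto
  ultimately have "closure {0..<1} \<subseteq> {t \<in> {0..1}. \<phi> (?f t) \<in> B}"
    by (rule closure_minimal[rotated])
  moreover have "(1::real) \<in> closure {0..<1}" by simp
  ultimately have "\<phi> (?f 1) \<in> B" by blast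
  then show ?thesis by simp
qed

lemma characteristic_map_into_closed:
  assumes "characteristic_map X E c \<phi>" "closedin X B" "snd c \<subseteq> B" "x \<in> topspace (disk (fst c))"
  shows "\<phi> x \<in> B"
  using assms disk_map_into_closedin[of "fst c" X \<phi> B x]
  by (auto simp: characteristic_map_def bij_betw_def)

lemma disjoint_cells_eq:
  "\<lbrakk>disjoint_family_on snd E; c \<in> E; d \<in> E; x \<in> snd c; x \<in> snd d\<rbrakk> \<Longrightarrow> c = d"
  unfolding disjoint_family_on_def by blast

text \<open>Closedness of \<open>B\<close> forces the closed cells of \<open>F\<close> into \<open>B\<close>, so by disjointness the cells met by their
  boundaries belong to \<open>F\<close> again.\<close>

lemma finite_CW_structure_subcomplex:
  assumes E: "finite_CW_structure X E" and B: "closedin X B" and F: "F \<subseteq> E" "B = (\<Union>c\<in>F. snd c)"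
  shows "finite_CW_structure (subtopology X B) F"
  unfolding finite_CW_structure_iff
proof (intro conjI ballI)
  have disj: "disjoint_family_on snd E" using E by (simp add: finite_CW_structure_iff)
  show "Hausdorff_space (subtopology X B)" "finite F"
    using E F(1) finite_subset by (auto simp: finite_CW_structure_iff Hausdorff_space_subtopology)
  show "topspace (subtopology X B) = (\<Union>c\<in>F. snd c)"
    using closedin_subset[OF B] F(2) by auto
  show "disjoint_family_on snd F" using disj F(1) by (rule disjoint_family_on_mono[rotated])
next
  have disj: "disjoint_family_on snd E" using E by (simp add: finite_CW_structure_iff)
  fix c assume c: "c \<in> F"
  then obtain \<phi> where phi: "characteristic_map X E c \<phi>"
    using E F(1) unfolding finite_CW_structure_iff by blast
  have "snd c \<subseteq> B" using c F(2) by auto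
  note into = characteristic_map_into_closed[OF phi B this]
  have "characteristic_map (subtopology X B) F c \<phi>"
    unfolding characteristic_map_def
  proof (intro conjI)
    show "continuous_map (disk (fst c)) (subtopology X B) \<phi>"
      using phi into by (auto simp: characteristic_map_def continuous_map_in_subtopology)
    show "bij_betw \<phi> (disk_interior (fst c)) (snd c)"
      using phi by (simp add: characteristic_map_def)
    show "\<phi> ` disk_boundary (fst c) \<subseteq> (\<Union>d\<in>{d \<in> F. fst d < fst c}. snd d)"
    proof
      fix y assume y: "y \<in> \<phi> ` disk_boundary (fst c)"
      have "\<phi> ` disk_boundary (fst c) \<subseteq> (\<Union>d\<in>{d \<in> E. fst d < fst c}. snd d)"
        using phi by (simp add: characteristic_map_def)
      from subsetD[OF this y] obtain d where d: "d \<in> E" "fst d < fst c" "y \<in> snd d" by blast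
      have "y \<in> B" using y into by (auto simp flip: disk_minus_interior)
      then obtain d' where "d' \<in> F" "y \<in> snd d'" using F(2) by auto
      then have "d' = d" using disjoint_cells_eq[OF disj] d F(1) by blast
      then show "y \<in> (\<Union>d\<in>{d \<in> F. fst d < fst c}. snd d)" using \<open>d' \<in> F\<close> d by blast
    qed
  qed
  then show "\<exists>\<phi>. characteristic_map (subtopology X B) F c \<phi>" by blast
qed

text \<open>A disk is regarded as a product over the index set \<open>{0}\<close>.\<close>

lemma polydisk_attached_if_characteristic_map:
  assumes phi: "characteristic_map X E c \<phi>"
  shows "polydisk_attached X (fst c) (snd c) (\<Union>d\<in>{d \<in> E. fst d < fst c}. snd d)"
proof -
  let ?n = "\<lambda>_::nat. fst c"
  let ?p = "\<lambda>x :: nat \<Rightarrow> nat \<Rightarrow> real. x 0"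
  have "continuous_map (polydisk {0} ?n) (disk (fst c)) ?p"
    unfolding polydisk_def by (intro continuous_map_product_projection) simp
  then have "continuous_map (polydisk {0} ?n) X (\<phi> \<circ> ?p)"
    using phi by (auto simp: characteristic_map_def intro: continuous_map_compose)
  moreover have "bij_betw (\<phi> \<circ> ?p) (polydisk_interior {0} ?n) (snd c)"
  proof (rule bij_betw_trans)
    show "bij_betw ?p (polydisk_interior {0} ?n) (disk_interior (fst c))"
      by (rule bij_betw_byWitness[where f' = "\<lambda>y. \<lambda>i\<in>{0}. y"])
        (auto simp: polydisk_interior_def PiE_def extensional_def fun_eq_iff)
    show "bij_betw \<phi> (disk_interior (fst c)) (snd c)"
      using phi by (simp add: characteristic_map_def)
  qed
  moreover have "(\<phi> \<circ> ?p) ` (topspace (polydisk {0} ?n) - polydisk_interior {0} ?n)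
      \<subseteq> (\<Union>d\<in>{d \<in> E. fst d < fst c}. snd d)"
  proof -
    have "?p ` (topspace (polydisk {0} ?n) - polydisk_interior {0} ?n) \<subseteq> disk_boundary (fst c)"
      by (auto simp: polydisk_def polydisk_interior_def PiE_def simp flip: disk_minus_interior)
    then have "(\<phi> \<circ> ?p) ` (topspace (polydisk {0} ?n) - polydisk_interior {0} ?n)
        \<subseteq> \<phi> ` disk_boundary (fst c)"
      unfolding image_comp[symmetric] by (rule image_mono)
    also have "\<dots> \<subseteq> (\<Union>d\<in>{d \<in> E. fst d < fst c}. snd d)"
      using phi by (simp add: characteristic_map_def)
    finally show ?thesis .
  qed
  ultimately show ?thesis
    unfolding polydisk_attached_def
    by (intro exI[of _ "{0}"] exI[of _ ?n] exI[of _ "\<phi> \<circ> ?p"] conjI) simp_all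
qed

lemma euler_characteristic_finite_CW:
  assumes "finite_CW_structure X E"
  shows "euler_characteristic X = (\<Sum>c\<in>E. (-1) ^ fst c)"
proof -
  have "polydisk_complex X E fst snd"
    using assms unfolding polydisk_complex_def finite_CW_structure_iff
    by (blast intro: polydisk_attached_if_characteristic_map)
  then show ?thesis by (intro euler_characteristic_eq has_euler_polydisk_complex)
qed

lemma bij_betw_PiE:
  assumes "\<And>i. i \<in> I \<Longrightarrow> bij_betw (f i) (A i) (B i)"
  shows "bij_betw (\<lambda>x. \<lambda>i\<in>I. f i (x i)) (Pi\<^sub>E I A) (Pi\<^sub>E I B)"
proof -
  let ?g = "\<lambda>i. inv_into (A i) (f i)"
  have f: "f i a \<in> B i" "?g i (f i a) = a" if "i \<in> I" "a \<in> A i" for i a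
    using assms[OF that(1)] that(2) by (auto simp: bij_betw_def)
  have g: "?g i b \<in> A i" "f i (?g i b) = b" if "i \<in> I" "b \<in> B i" for i b
    using assms[OF that(1)] that(2) by (auto simp: bij_betw_def inv_into_into f_inv_into_f)
  show ?thesis
  proof (rule bij_betw_byWitness[where f' = "\<lambda>y. \<lambda>i\<in>I. ?g i (y i)"])
    show "\<forall>x\<in>Pi\<^sub>E I A. (\<lambda>i\<in>I. ?g i ((\<lambda>i\<in>I. f i (x i)) i)) = x"
    proof
      fix x assume "x \<in> Pi\<^sub>E I A"
      then show "(\<lambda>i\<in>I. ?g i ((\<lambda>i\<in>I. f i (x i)) i)) = x"
        using f(2) by (intro extensionalityI[of _ I]) (simp_all add: PiE_iff)
    qed
    show "\<forall>y\<in>Pi\<^sub>E I B. (\<lambda>i\<in>I. f i ((\<lambda>i\<in>I. ?g i (y i)) i)) = y"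
    proof
      fix y assume "y \<in> Pi\<^sub>E I B"
      then show "(\<lambda>i\<in>I. f i ((\<lambda>i\<in>I. ?g i (y i)) i)) = y"
        using g(2) by (intro extensionalityI[of _ I]) (simp_all add: PiE_iff)
    qed
    show "(\<lambda>x. \<lambda>i\<in>I. f i (x i)) ` Pi\<^sub>E I A \<subseteq> Pi\<^sub>E I B"
      using f(1) by (intro image_subsetI) (simp add: PiE_iff)
    show "(\<lambda>y. \<lambda>i\<in>I. ?g i (y i)) ` Pi\<^sub>E I B \<subseteq> Pi\<^sub>E I A"
      using g(1) by (intro image_subsetI) (simp add: PiE_iff)
  qed
qed

text \<open>The cells are the products of cells \<open>c i\<close> of the factors, subject to the condition that the indices
  of the cells outside the subcomplexes form a simplex; this set of indices is the support of
  every point of the product cell. A closed cell of \<open>F i\<close> stays in \<open>B i\<close>, so the support can only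
  shrink on the boundary of a product cell, and \<open>S\<close> is closed under subsets: the product of the
  characteristic maps takes values in the polyhedral product. At a boundary point some coordinate
  lies on the boundary of its disk and is mapped to a cell of smaller dimension, while no other
  coordinate moves to a cell of larger dimension.\<close>

lemma polydisk_complex_polyhedral_product:
  fixes m :: nat and E F :: "nat \<Rightarrow> (nat \<times> 'a set) set"
  assumes S: "\<And>J J'. \<lbrakk>J \<in> S; J' \<subseteq> J\<rbrakk> \<Longrightarrow> J' \<in> S"
    and E: "\<And>i. i \<in> {1..m} \<Longrightarrow> finite_CW_structure (A i) (E i)"
    and B: "\<And>i. i \<in> {1..m} \<Longrightarrow> closedin (A i) (B i)"
    and F: "\<And>i. i \<in> {1..m} \<Longrightarrow> F i \<subseteq> E i" "\<And>i. i \<in> {1..m} \<Longrightarrow> B i = (\<Union>c\<in>F i. snd c)"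
  shows "polydisk_complex (polyhedral_product m S A B)
    {c \<in> Pi\<^sub>E {1..m} E. {i \<in> {1..m}. c i \<notin> F i} \<in> S}
    (\<lambda>c. \<Sum>i\<in>{1..m}. fst (c i)) (\<lambda>c. \<Pi>\<^sub>E i\<in>{1..m}. snd (c i))"
proof -
  let ?I = "{1..m}"
  let ?X = "polyhedral_product m S A B"
  let ?K = "{c \<in> Pi\<^sub>E ?I E. {i \<in> ?I. c i \<notin> F i} \<in> S}"
  let ?d = "\<lambda>c :: nat \<Rightarrow> nat \<times> 'a set. \<Sum>i\<in>?I. fst (c i)"
  let ?e = "\<lambda>c :: nat \<Rightarrow> nat \<times> 'a set. \<Pi>\<^sub>E i\<in>?I. snd (c i)"
  have topX: "topspace ?X = {x \<in> \<Pi>\<^sub>E i\<in>?I. topspace (A i). Supp m B x \<in> S}"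
    by (auto simp: polyhedral_product_def Let_def)
  have topA: "topspace (A i) = (\<Union>c\<in>E i. snd c)" and disj: "disjoint_family_on snd (E i)"
    and finE: "finite (E i)" and HA: "Hausdorff_space (A i)" if "i \<in> ?I" for i
    using E[OF that] by (simp_all add: finite_CW_structure_iff)
  have mem_B: "x \<in> B i \<longleftrightarrow> c \<in> F i" if i: "i \<in> ?I" and c: "c \<in> E i" "x \<in> snd c" for i c x
  proof
    assume "x \<in> B i"
    then obtain d where "d \<in> F i" "x \<in> snd d" using F(2)[OF i] by auto
    moreover have "d = c" using disjoint_cells_eq[OF disj[OF i]] F(1)[OF i] c calculation by blast
    ultimately show "c \<in> F i" by simp
  next
    assume "c \<in> F i"
    then show "x \<in> B i" using F(2)[OF i] c(2) by auto
  qed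
  have supp: "Supp m B x = {i \<in> ?I. c i \<notin> F i}" if "c \<in> Pi\<^sub>E ?I E" "x \<in> ?e c" for c x
  proof -
    have "x i \<in> B i \<longleftrightarrow> c i \<in> F i" if "i \<in> ?I" for i
      using mem_B[OF that, of "c i" "x i"] \<open>c \<in> Pi\<^sub>E ?I E\<close> \<open>x \<in> ?e c\<close> that
      by (auto simp: PiE_iff)
    then show ?thesis by (auto simp: Supp_def)
  qed
  have e_sub: "?e c \<subseteq> topspace ?X" if c: "c \<in> ?K" for c
  proof
    fix x assume x: "x \<in> ?e c"
    have "x i \<in> topspace (A i)" if i: "i \<in> ?I" for i
    proof -
      have "c i \<in> E i" "x i \<in> snd (c i)" using x c i by (simp_all add: PiE_iff)
      then show ?thesis unfolding topA[OF i] by (rule UN_I)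
    qed
    then have "x \<in> (\<Pi>\<^sub>E i\<in>?I. topspace (A i))" using x by (simp add: PiE_iff)
    then show "x \<in> topspace ?X" using supp[of c x] c x by (simp add: topX)
  qed
  have cell_of: "\<exists>c\<in>?K. x \<in> ?e c" if x: "x \<in> topspace ?X" for x
  proof -
    have "\<forall>i\<in>?I. \<exists>c. c \<in> E i \<and> x i \<in> snd c"
    proof
      fix i assume i: "i \<in> ?I"
      then have "x i \<in> topspace (A i)" using x by (simp add: topX PiE_iff)
      then show "\<exists>c. c \<in> E i \<and> x i \<in> snd c" unfolding topA[OF i] by blast
    qed
    from bchoice[OF this] obtain c where c: "\<forall>i\<in>?I. c i \<in> E i \<and> x i \<in> snd (c i)" ..
    let ?c = "restrict c ?I"
    have 1: "?c \<in> Pi\<^sub>E ?I E" using c by auto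
    have 2: "x \<in> ?e ?c" using c x by (auto simp: topX PiE_iff)
    have "{i \<in> ?I. ?c i \<notin> F i} \<in> S" using supp[OF 1 2] x by (simp add: topX)
    with 1 2 show ?thesis by blast
  qed
  have eq_cells: "c i = d i" if "i \<in> ?I" "c \<in> Pi\<^sub>E ?I E" "d \<in> Pi\<^sub>E ?I E" "y i \<in> snd (c i)" "y i \<in> snd (d i)"
    for i c d and y :: "nat \<Rightarrow> 'a"
    using disjoint_cells_eq[OF disj[OF that(1)]] that by (auto simp: PiE_iff)
  show ?thesis
    unfolding polydisk_complex_def
  proof (intro conjI ballI)
    show "Hausdorff_space ?X"
      unfolding polyhedral_product_def Let_def using HA
      by (intro Hausdorff_space_subtopology) (simp add: Hausdorff_space_product_topology)
    show "finite ?K" using finE by (intro finite_subset[of ?K "Pi\<^sub>E ?I E"] finite_PiE) auto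
    show "topspace ?X = (\<Union>c\<in>?K. ?e c)"
    proof
      show "topspace ?X \<subseteq> (\<Union>c\<in>?K. ?e c)" using cell_of by blast
      show "(\<Union>c\<in>?K. ?e c) \<subseteq> topspace ?X" using e_sub by (rule UN_least)
    qed
    show "disjoint_family_on ?e ?K"
      unfolding disjoint_family_on_def
    proof (intro ballI impI)
      fix c d assume c: "c \<in> ?K" and d: "d \<in> ?K" and ne: "c \<noteq> d"
      show "?e c \<inter> ?e d = {}"
      proof (rule ccontr)
        assume "?e c \<inter> ?e d \<noteq> {}"
        then obtain y where y: "y \<in> ?e c" "y \<in> ?e d" by auto
        have "c = d"
        proof (rule PiE_ext)
          show "c \<in> Pi\<^sub>E ?I E" "d \<in> Pi\<^sub>E ?I E" using c d by auto
          show "c i = d i" if "i \<in> ?I" for i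
            by (rule eq_cells[OF that, of c d y]) (use c d y that in \<open>auto simp: PiE_iff\<close>)
        qed
        with ne show False by simp
      qed
    qed
  next
    fix c assume c: "c \<in> ?K"
    then have cE: "c \<in> Pi\<^sub>E ?I E" and cS: "{i \<in> ?I. c i \<notin> F i} \<in> S" by auto
    have ci: "c i \<in> E i" if "i \<in> ?I" for i using cE that by auto
    have "\<forall>i\<in>?I. \<exists>\<phi>. characteristic_map (A i) (E i) (c i) \<phi>"
      using E ci unfolding finite_CW_structure_iff by blast
    from bchoice[OF this]
    obtain \<phi> where phi': "\<forall>i\<in>?I. characteristic_map (A i) (E i) (c i) (\<phi> i)" ..
    then have phi: "characteristic_map (A i) (E i) (c i) (\<phi> i)" if "i \<in> ?I" for i using that by blast
    let ?n = "\<lambda>i. fst (c i)"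
    let ?D = "polydisk ?I ?n" and ?U = "polydisk_interior ?I ?n"
    let ?f = "\<lambda>x. \<lambda>i\<in>?I. \<phi> i (x i)"
    have xi: "x i \<in> topspace (disk (?n i))" if "x \<in> topspace ?D" "i \<in> ?I" for x i
      using that by (auto simp: polydisk_def)
    have f_cont: "continuous_map ?D (product_topology A ?I) ?f"
      unfolding continuous_map_componentwise
    proof (intro conjI ballI)
      fix i assume i: "i \<in> ?I"
      have "continuous_map ?D (disk (?n i)) (\<lambda>x. x i)"
        unfolding polydisk_def by (rule continuous_map_product_projection[OF i])
      moreover have "continuous_map (disk (?n i)) (A i) (\<phi> i)"
        using phi[OF i] by (simp add: characteristic_map_def)
      ultimately have "continuous_map ?D (A i) (\<phi> i \<circ> (\<lambda>x. x i))" by (rule continuous_map_compose)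
      then show "continuous_map ?D (A i) (\<lambda>x. ?f x i)" using i by (simp add: o_def)
    qed auto
    have f_top: "?f x \<in> topspace (product_topology A ?I)" if "x \<in> topspace ?D" for x
      using f_cont that unfolding continuous_map_def by blast
    have f_supp: "Supp m B (?f x) \<in> S" if x: "x \<in> topspace ?D" for x
    proof (rule S[OF cS])
      have "?f x i \<in> B i" if i: "i \<in> ?I" and "c i \<in> F i" for i
      proof -
        have "snd (c i) \<subseteq> B i" using F(2)[OF i] that by auto
        from characteristic_map_into_closed[OF phi[OF i] B[OF i] this xi[OF x i]]
        show ?thesis using i by simp
      qed
      then show "Supp m B (?f x) \<subseteq> {i \<in> ?I. c i \<notin> F i}" by (auto simp: Supp_def)
    qed
    have f_X: "?f x \<in> topspace ?X" if "x \<in> topspace ?D" for x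
      using f_top[OF that] f_supp[OF that] by (simp add: topX)
    have cont: "continuous_map ?D ?X ?f"
      unfolding polyhedral_product_def Let_def
      using f_cont f_top f_supp by (auto simp: continuous_map_in_subtopology)
    have bij: "bij_betw ?f ?U (?e c)"
      unfolding polydisk_interior_def
      using phi by (intro bij_betw_PiE) (simp add: characteristic_map_def)
    have bd: "?f ` (topspace ?D - ?U) \<subseteq> (\<Union>d\<in>{d \<in> ?K. ?d d < ?d c}. ?e d)"
    proof
      fix y assume "y \<in> ?f ` (topspace ?D - ?U)"
      then obtain x where x: "x \<in> topspace ?D" "x \<notin> ?U" "y = ?f x" by blast
      obtain d where d: "d \<in> ?K" "y \<in> ?e d" using cell_of[OF f_X[OF x(1)]] x(3) by blast
      have dE: "d \<in> Pi\<^sub>E ?I E" using d(1) by simp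
      have yi: "\<phi> i (x i) \<in> snd (d i)" if "i \<in> ?I" for i
        using d(2) that x(3) by (auto simp: PiE_iff)
      have int: "d i = c i" if i: "i \<in> ?I" and "x i \<in> disk_interior (?n i)" for i
      proof -
        have "\<phi> i (x i) \<in> snd (c i)"
          using phi[OF i] that(2) by (auto simp: characteristic_map_def bij_betw_def)
        then show ?thesis
          by (intro disjoint_cells_eq[OF disj[OF i] _ ci[OF i] yi[OF i]]) (use dE i in auto)
      qed
      have less: "fst (d i) < fst (c i)" if i: "i \<in> ?I" and "x i \<notin> disk_interior (?n i)" for i
      proof -
        have "x i \<in> disk_boundary (?n i)"
          using xi[OF x(1) i] that(2) by (simp flip: disk_minus_interior)
        then have "\<phi> i (x i) \<in> (\<Union>d\<in>{d \<in> E i. fst d < fst (c i)}. snd d)"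
          using phi[OF i] unfolding characteristic_map_def by blast
        then obtain d' where d': "d' \<in> E i" "fst d' < fst (c i)" "\<phi> i (x i) \<in> snd d'" by auto
        have "d i \<in> E i" using dE i by auto
        from disjoint_cells_eq[OF disj[OF i] this d'(1) yi[OF i] d'(3)] d'(2)
        show ?thesis by simp
      qed
      have "\<exists>i\<in>?I. x i \<notin> disk_interior (?n i)"
        using x(1,2) by (auto simp: polydisk_def polydisk_interior_def PiE_iff)
      then obtain i0 where i0: "i0 \<in> ?I" "x i0 \<notin> disk_interior (?n i0)" by blast
      have "?d d < ?d c"
      proof (rule sum_strict_mono_ex1)
        show "\<forall>i\<in>?I. fst (d i) \<le> fst (c i)"
        proof
          fix i assume "i \<in> ?I"
          then show "fst (d i) \<le> fst (c i)"
            using int[of i] less[of i] by (cases "x i \<in> disk_interior (?n i)") auto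
        qed
        show "\<exists>i\<in>?I. fst (d i) < fst (c i)" using less[OF i0] i0(1) by blast
      qed simp
      then show "y \<in> (\<Union>d\<in>{d \<in> ?K. ?d d < ?d c}. ?e d)" using d by blast
    qed
    show "polydisk_attached ?X (?d c) (?e c) (\<Union>d\<in>{d \<in> ?K. ?d d < ?d c}. ?e d)"
      unfolding polydisk_attached_def using cont bij bd
      by (intro exI[of _ ?I] exI[of _ ?n] exI[of _ ?f] conjI) simp_all
  qed
qed

text \<open>The tuples with support \<open>J\<close> form a product of sets, over which a sum of products is the product of
  the sums.\<close>

lemma sum_over_supports:
  fixes w :: "'c \<Rightarrow> int"
  assumes I: "finite I" and E: "\<And>i. i \<in> I \<Longrightarrow> finite (E i)" and F: "\<And>i. i \<in> I \<Longrightarrow> F i \<subseteq> E i"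
    and S: "S \<subseteq> Pow I"
  shows "(\<Sum>c | c \<in> Pi\<^sub>E I E \<and> {i \<in> I. c i \<notin> F i} \<in> S. \<Prod>i\<in>I. w (c i))
    = (\<Sum>J\<in>S. (\<Prod>j\<in>J. sum w (E j) - sum w (F j)) * (\<Prod>j\<in>I - J. sum w (F j)))"
proof -
  let ?T = "\<lambda>J i. if i \<in> J then E i - F i else F i"
  have finT: "finite (?T J i)" if "i \<in> I" for J i
    using E[OF that] F[OF that] finite_subset by auto
  have supp: "{i \<in> I. c i \<notin> F i} = J" if "J \<in> S" "c \<in> Pi\<^sub>E I (?T J)" for c J
  proof -
    have "c i \<notin> F i \<longleftrightarrow> i \<in> J" if "i \<in> I" for i
      using PiE_mem[OF \<open>c \<in> Pi\<^sub>E I (?T J)\<close> that] by (auto split: if_splits)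
    then show ?thesis using S \<open>J \<in> S\<close> by auto
  qed
  have mem_E: "c \<in> Pi\<^sub>E I E" if "c \<in> Pi\<^sub>E I (?T J)" for c J
  proof -
    have "c i \<in> E i" if "i \<in> I" for i
      using PiE_mem[OF \<open>c \<in> Pi\<^sub>E I (?T J)\<close> that] F[OF that] by (auto split: if_splits)
    then show ?thesis using that by (simp add: PiE_iff)
  qed
  have mem_T: "c \<in> Pi\<^sub>E I (?T {i \<in> I. c i \<notin> F i})" if "c \<in> Pi\<^sub>E I E" for c
    using that by (auto simp: PiE_iff)
  have K: "{c \<in> Pi\<^sub>E I E. {i \<in> I. c i \<notin> F i} \<in> S} = (\<Union>J\<in>S. Pi\<^sub>E I (?T J))"
  proof (intro equalityI subsetI)
    fix c assume "c \<in> {c \<in> Pi\<^sub>E I E. {i \<in> I. c i \<notin> F i} \<in> S}"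
    then show "c \<in> (\<Union>J\<in>S. Pi\<^sub>E I (?T J))"
      using mem_T[of c] by (intro UN_I[of "{i \<in> I. c i \<notin> F i}"]) auto
  next
    fix c assume "c \<in> (\<Union>J\<in>S. Pi\<^sub>E I (?T J))"
    then obtain J where J: "J \<in> S" "c \<in> Pi\<^sub>E I (?T J)" by (rule UN_E)
    show "c \<in> {c \<in> Pi\<^sub>E I E. {i \<in> I. c i \<notin> F i} \<in> S}"
      using mem_E[OF J(2)] supp[OF J] J(1) by simp
  qed
  have "(\<Sum>c\<in>(\<Union>J\<in>S. Pi\<^sub>E I (?T J)). \<Prod>i\<in>I. w (c i))
      = (\<Sum>J\<in>S. \<Sum>c\<in>Pi\<^sub>E I (?T J). \<Prod>i\<in>I. w (c i))"
  proof (rule sum.UNION_disjoint)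
    show "finite S" using I S finite_subset by blast
    show "\<forall>J\<in>S. finite (Pi\<^sub>E I (?T J))" using finT I by (intro ballI finite_PiE) auto
    show "\<forall>J\<in>S. \<forall>J'\<in>S. J \<noteq> J' \<longrightarrow> Pi\<^sub>E I (?T J) \<inter> Pi\<^sub>E I (?T J') = {}"
    proof (intro ballI impI)
      fix J J' assume J: "J \<in> S" "J' \<in> S" "J \<noteq> J'"
      show "Pi\<^sub>E I (?T J) \<inter> Pi\<^sub>E I (?T J') = {}"
        using supp[OF J(1)] supp[OF J(2)] J(3) by blast
    qed
  qed
  also have "\<dots> = (\<Sum>J\<in>S. (\<Prod>j\<in>J. sum w (E j) - sum w (F j)) * (\<Prod>j\<in>I - J. sum w (F j)))"
  proof (rule sum.cong[OF refl])
    fix J assume "J \<in> S"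
    then have J: "J \<subseteq> I" using S by auto
    have "(\<Sum>c\<in>Pi\<^sub>E I (?T J). \<Prod>i\<in>I. w (c i)) = (\<Prod>i\<in>I. sum w (?T J i))"
      using prod_sum_PiE[OF I, of "?T J" "\<lambda>_. w"] finT by simp
    also have "\<dots> = (\<Prod>i\<in>I - J. sum w (?T J i)) * (\<Prod>i\<in>J. sum w (?T J i))"
      by (rule prod.subset_diff[OF J I])
    also have "(\<Prod>i\<in>I - J. sum w (?T J i)) = (\<Prod>i\<in>I - J. sum w (F i))"
      by (rule prod.cong) auto
    also have "(\<Prod>i\<in>J. sum w (?T J i)) = (\<Prod>i\<in>J. sum w (E i) - sum w (F i))"
      using J E F by (intro prod.cong) (auto simp: sum_diff)
    finally show "(\<Sum>c\<in>Pi\<^sub>E I (?T J). \<Prod>i\<in>I. w (c i))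
        = (\<Prod>j\<in>J. sum w (E j) - sum w (F j)) * (\<Prod>j\<in>I - J. sum w (F j))"
      by (simp add: mult.commute)
  qed
  finally show ?thesis by (simp add: K)
qed

theorem mainTheorem1:
  fixes m :: nat
    and S :: "nat set set"
    and A :: "nat \<Rightarrow> 'a topology"
    and B :: "nat \<Rightarrow> 'a set"
  assumes "simplex_poset {1..m} S"
    and "\<And>i. i \<in> {1..m} \<Longrightarrow> finite_CW_pair (A i) (B i)"
  shows "euler_characteristic (polyhedral_product m S A B) =
    (\<Sum>J\<in>S.
       (\<Prod>j\<in>J. euler_characteristic (A j) - euler_characteristic (subtopology (A j) (B j))) *
       (\<Prod>j\<in>{1..m} - J. euler_characteristic (subtopology (A j) (B j))))"
proof -
  let ?I = "{1..m}"
  have S1: "S \<subseteq> Pow ?I" and "\<forall>J\<in>S. \<forall>J'. J' \<subseteq> J \<longrightarrow> J' \<in> S"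
    using assms(1) by (simp_all add: simplex_poset_def)
  then have S2: "J' \<in> S" if "J \<in> S" "J' \<subseteq> J" for J J'
    using that by blast
  have "\<forall>i\<in>?I. \<exists>EF. finite_CW_structure (A i) (fst EF) \<and> closedin (A i) (B i) \<and>
      snd EF \<subseteq> fst EF \<and> B i = (\<Union>c\<in>snd EF. snd c)"
  proof
    fix i assume "i \<in> ?I"
    then have "finite_CW_pair (A i) (B i)" by (rule assms(2))
    then obtain E where E: "finite_CW_structure (A i) E" "CW_subcomplex (A i) E (B i)"
      by (auto simp: finite_CW_pair_def)
    then obtain F where "closedin (A i) (B i)" "F \<subseteq> E" "B i = (\<Union>(n, e)\<in>F. e)"
      by (auto simp: CW_subcomplex_def)
    with E(1) show "\<exists>EF. finite_CW_structure (A i) (fst EF) \<and> closedin (A i) (B i) \<and>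
      snd EF \<subseteq> fst EF \<and> B i = (\<Union>c\<in>snd EF. snd c)"
      by (intro exI[of _ "(E, F)"]) (simp add: case_prod_unfold)
  qed
  from bchoice[OF this] obtain EF where EF: "\<forall>i\<in>?I. finite_CW_structure (A i) (fst (EF i)) \<and>
      closedin (A i) (B i) \<and> snd (EF i) \<subseteq> fst (EF i) \<and> B i = (\<Union>c\<in>snd (EF i). snd c)" ..
  define E where "E i = fst (EF i)" for i
  define F where "F i = snd (EF i)" for i
  have E: "finite_CW_structure (A i) (E i)" and B: "closedin (A i) (B i)"
    and F: "F i \<subseteq> E i" "B i = (\<Union>c\<in>F i. snd c)" if "i \<in> ?I" for i
    using bspec[OF EF that] by (auto simp: E_def F_def)
  let ?w = "\<lambda>c :: nat \<times> 'a set. (-1 :: int) ^ fst c"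
  have eA: "euler_characteristic (A i) = sum ?w (E i)" if "i \<in> ?I" for i
    by (rule euler_characteristic_finite_CW[OF E[OF that]])
  have eB: "euler_characteristic (subtopology (A i) (B i)) = sum ?w (F i)" if "i \<in> ?I" for i
    by (rule euler_characteristic_finite_CW[OF finite_CW_structure_subcomplex[OF E[OF that] B[OF that] F[OF that]]])
  have finE: "finite (E i)" if "i \<in> ?I" for i using E[OF that] by (simp add: finite_CW_structure_iff)
  have "polydisk_complex (polyhedral_product m S A B)
      {c \<in> Pi\<^sub>E ?I E. {i \<in> ?I. c i \<notin> F i} \<in> S}
      (\<lambda>c. \<Sum>i\<in>?I. fst (c i)) (\<lambda>c. \<Pi>\<^sub>E i\<in>?I. snd (c i))"
    by (rule polydisk_complex_polyhedral_product[OF S2 E B F])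
  from euler_characteristic_eq[OF has_euler_polydisk_complex[OF this]]
  have "euler_characteristic (polyhedral_product m S A B)
      = (\<Sum>c | c \<in> Pi\<^sub>E ?I E \<and> {i \<in> ?I. c i \<notin> F i} \<in> S. (-1) ^ (\<Sum>i\<in>?I. fst (c i)))" .
  also have "\<dots> = (\<Sum>c | c \<in> Pi\<^sub>E ?I E \<and> {i \<in> ?I. c i \<notin> F i} \<in> S. \<Prod>i\<in>?I. ?w (c i))"
    by (simp add: power_sum)
  also have "\<dots> = (\<Sum>J\<in>S. (\<Prod>j\<in>J. sum ?w (E j) - sum ?w (F j)) * (\<Prod>j\<in>?I - J. sum ?w (F j)))"
    by (rule sum_over_supports[OF _ finE F(1) S1]) auto
  also have "\<dots> = (\<Sum>J\<in>S.
       (\<Prod>j\<in>J. euler_characteristic (A j) - euler_characteristic (subtopology (A j) (B j))) *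
       (\<Prod>j\<in>?I - J. euler_characteristic (subtopology (A j) (B j))))"
  proof (rule sum.cong[OF refl], rule arg_cong2[where f = "(*)"])
    fix J assume "J \<in> S"
    then have J: "J \<subseteq> ?I" using S1 by auto
    show "(\<Prod>j\<in>J. sum ?w (E j) - sum ?w (F j))
      = (\<Prod>j\<in>J. euler_characteristic (A j) - euler_characteristic (subtopology (A j) (B j)))"
      using J by (intro prod.cong) (auto simp: eA eB subset_iff)
    show "(\<Prod>j\<in>?I - J. sum ?w (F j))
      = (\<Prod>j\<in>?I - J. euler_characteristic (subtopology (A j) (B j)))"
      by (intro prod.cong) (auto simp: eB)
  qed
  finally show ?thesis .
qed

end
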